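(* Let $G=(V,E)$ be a $d$-uniform hypergraph with $n$ vertices and $m$ hyperedges. With high probability, the algorithm Greedy (defined in the context, run with $k=\sqrt{m/n}$ machines) computes a matching of $G$ that is a $\big(3d(d-1)+3+o(1)\big)$-approximation for the $d$-Uniform Hypergraph Matching problem, and it can be implemented in 3 MPC rounds on machines of memory $s=\tilde{O}(\sqrt{nm})$.
   Context: A hypergraph $G=(V,E)$ is $d$-uniform if every hyperedge is a set of exactly $d$ vertices. A matching is a set of pairwise disjoint hyperedges; $\mu(G)$ is the maximum cardinality of a matching of $G$. The $d$-Uniform Hypergraph Matching problem asks for a matching of maximum cardinality in a given $d$-uniform hypergraph; a matching $M$ is a $\rho$-approximation if $\rho\,|M|\ge \mu(G)$. MPC (Massively Parallel Computation) model: an input of size $N$ is distributed over $k$ machines, each with space $s$, where $k\cdot s=\tilde O(N)$. Computation proceeds in synchronous rounds. In each round every machine performs arbitrary local computation on its data (of size at most $s$; there is no restriction on computational power) and then sends messages to other machines; the total communication sent or received by a machine in a round is at most $s$. The received messages are its input for the next round. $\tilde O$ hides polylogarithmic factors. Random $k$-partition: each edge $e\in E$ is assigned independently to one of $E^{(1)},\dots,E^{(k)}$ chosen uniformly at random; $G^{(i)}:=(V,E^{(i)})$. Algorithm Greedy: construct a random $k$-partition $G^{(1)},\dots,G^{(k)}$ of $G$ across the $k$ machines and set $M^{(0)}:=\emptyset$. For $i=1,\dots,k$: let $MM(G^{(i)})$ be an arbitrary maximum matching of $G^{(i)}$, and let $M^{(i)}$ be a maximal matching obtained by adding to $M^{(i-1)}$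 edges of $MM(G^{(i)})$ that do not violate the matching property. Output $M:=M^{(k)}$. "With high probability" means with probability $1-o(1)$; asymptotic notation is as $n\to\infty$.
   Formalization: The approximation guarantee is stated for hypergraphs whose maximum matching size μ(G) tends to infinity with n (at any rate); for bounded μ(G) the high-probability claim fails for adversarial choices of the maximum matchings. *)

theory Defs
  imports "HOL-Probability.Probability"
begin

section \<open>Matchings in uniform hypergraphs\<close>

definition uniform_hypergraph :: "nat \<Rightarrow> 'a set \<Rightarrow> 'a set set \<Rightarrow> bool" where
  "uniform_hypergraph d V E \<longleftrightarrow> finite V \<and> (\<forall>e\<in>E. e \<subseteq> V \<and> card e = d)"

definition is_matching :: "'a set set \<Rightarrow> 'a set set \<Rightarrow> bool" where
  "is_matching E M \<longleftrightarrow> M \<subseteq> E \<and> pairwise disjnt M"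

definition matching_number :: "'a set set \<Rightarrow> nat" where
  "matching_number E = Max (card ` {M. is_matching E M})"

definition is_maximum_matching :: "'a set set \<Rightarrow> 'a set set \<Rightarrow> bool" where
  "is_maximum_matching E M \<longleftrightarrow> is_matching E M \<and> card M = matching_number E"

definition approximates :: "real \<Rightarrow> 'a set set \<Rightarrow> 'a set set \<Rightarrow> bool" where
  "approximates \<rho> E M \<longleftrightarrow> is_matching E M \<and> \<rho> * real (card M) \<ge> real (matching_number E)"


section \<open>Random partition and the algorithm Greedy\<close>

text \<open>The \<open>k\<close> machines are numbered from \<open>0\<close> to \<open>k - 1\<close>. A partition is the function mapping
  a machine to its set of edges. The number \<open>sqrt (m / n)\<close> is rounded up, and to 1 if there are
  no edges.\<close>

definition num_machines :: "nat \<Rightarrow> nat \<Rightarrow> nat" where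
  "num_machines n m = max 1 (nat \<lceil>sqrt (real m / real n)\<rceil>)"

definition random_partition :: "nat \<Rightarrow> 'a set set \<Rightarrow> (nat \<Rightarrow> 'a set set) pmf" where
  "random_partition k E =
     map_pmf (\<lambda>a i. {e\<in>E. a e = i}) (Pi_pmf E 0 (\<lambda>_. pmf_of_set {..<k}))"

definition greedy_step :: "'a set set \<Rightarrow> 'a set set \<Rightarrow> 'a set set" where
  "greedy_step M N = M \<union> {e\<in>N. \<forall>f\<in>M. disjnt e f}"

text \<open>Since \<open>N\<close> is itself a matching, the maximal matching that is obtained by adding edges of
  \<open>N\<close> to \<open>M\<close> is unique.\<close>

lemma greedy_step_unique_maximal:
  assumes "pairwise disjnt M" "pairwise disjnt N"
  shows "(M \<subseteq> M' \<and> M' \<subseteq> M \<union> N \<and> pairwise disjnt M' \<and>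
          (\<forall>e\<in>N - M'. \<not> pairwise disjnt (insert e M'))) \<longleftrightarrow> M' = greedy_step M N"
    (is "?L \<longleftrightarrow> ?R")
proof
  assume L: ?L
  show ?R
  proof
    show "M' \<subseteq> greedy_step M N"
    proof
      fix e assume e: "e \<in> M'"
      show "e \<in> greedy_step M N"
      proof (cases "e \<in> M")
        case False
        then have "e \<in> N" using e L by auto
        moreover have "disjnt e f" if "f \<in> M" for f
          using that L e False by (metis pairwiseD subsetD)
        ultimately show ?thesis by (auto simp: greedy_step_def)
      qed (auto simp: greedy_step_def)
    qed
    show "greedy_step M N \<subseteq> M'"
    proof
      fix e assume e: "e \<in> greedy_step M N"
      show "e \<in> M'"
      proof (rule ccontr)
        assume n: "e \<notin> M'"
        then have eN: "e \<in> N" and ed: "\<And>f. f \<in> M \<Longrightarrow> disjnt e f"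
          using e L by (auto simp: greedy_step_def)
        have "disjnt e f" if "f \<in> M'" for f
        proof (cases "f \<in> M")
          case False
          then have "f \<in> N" using L that by auto
          then show ?thesis using eN n that assms(2) by (metis pairwiseD)
        qed (rule ed)
        then have "pairwise disjnt (insert e M')"
          using L by (auto simp: pairwise_insert disjnt_sym)
        then show False using L eN n by auto
      qed
    qed
  qed
next
  assume R: ?R
  have "pairwise disjnt M'"
    using assms unfolding R greedy_step_def pairwise_def by (auto simp: disjnt_sym)
  moreover have "\<not> pairwise disjnt (insert e M')" if "e \<in> N - M'" for e
  proof -
    obtain f where "f \<in> M" "\<not> disjnt e f" "e \<notin> M'"
      using \<open>e \<in> N - M'\<close> by (auto simp: R greedy_step_def)
    moreover have "f \<in> M'" "f \<noteq> e" using calculation by (auto simp: R greedy_step_def)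
    ultimately show ?thesis by (auto simp: pairwise_insert)
  qed
  ultimately show ?L by (auto simp: R greedy_step_def)
qed

primrec greedy :: "(nat \<Rightarrow> 'a set set) \<Rightarrow> nat \<Rightarrow> 'a set set" where
  "greedy N 0 = {}"
| "greedy N (Suc i) = greedy_step (greedy N i) (N i)"

text \<open>The arbitrary maximum matchings are given by a rule \<open>MM\<close>: machine \<open>i\<close> chooses \<open>MM i F\<close>
  from the set \<open>F\<close> of edges that it has received, without knowing the other parts of the
  partition.\<close>

definition maximum_matching_rule ::
    "nat \<Rightarrow> 'a set \<Rightarrow> (nat \<Rightarrow> 'a set set \<Rightarrow> 'a set set) \<Rightarrow> bool" where
  "maximum_matching_rule d V MM \<longleftrightarrow>
     (\<forall>i F. uniform_hypergraph d V F \<longrightarrow> is_maximum_matching F (MM i F))"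

definition greedy_output ::
    "nat \<Rightarrow> (nat \<Rightarrow> 'a set set \<Rightarrow> 'a set set) \<Rightarrow> 'a set set \<Rightarrow> 'a set set pmf" where
  "greedy_output k MM E = map_pmf (\<lambda>P. greedy (\<lambda>i. MM i (P i)) k) (random_partition k E)"


section \<open>The MPC model\<close>

text \<open>All data are bit strings. In a state \<open>X\<close>, the string \<open>X j i\<close> is the message that machine
  \<open>j\<close> has received from machine \<open>i\<close>; together, the strings \<open>X j 0, \<dots>, X j (k - 1)\<close> are
  the whole memory of machine \<open>j\<close>. What a machine wants to keep, it sends to itself.

  An algorithm gives, for each round \<open>r\<close> and machine \<open>i\<close>, an arbitrary randomized map from the
  memory of \<open>i\<close> to its messages, indexed by their recipients. The machines draw their random bits
  independently.\<close>

type_synonym mpc_state = "nat \<Rightarrow> nat \<Rightarrow> bool list"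

type_synonym mpc_algorithm = "nat \<Rightarrow> nat \<Rightarrow> (nat \<Rightarrow> bool list) \<Rightarrow> (nat \<Rightarrow> bool list) pmf"

definition mpc_round ::
    "nat \<Rightarrow> (nat \<Rightarrow> (nat \<Rightarrow> bool list) \<Rightarrow> (nat \<Rightarrow> bool list) pmf) \<Rightarrow> mpc_state \<Rightarrow> mpc_state pmf" where
  "mpc_round k f X =
     map_pmf (\<lambda>Y j i. Y i j) (Pi_pmf {..<k} (\<lambda>_. []) (\<lambda>i. f i (X i)))"

text \<open>The sequence of all states of a run, the latest one first.\<close>

primrec mpc_run ::
    "nat \<Rightarrow> mpc_algorithm \<Rightarrow> nat \<Rightarrow> mpc_state \<Rightarrow> mpc_state list pmf" where
  "mpc_run k A 0 X = return_pmf [X]"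
| "mpc_run k A (Suc r) X =
     bind_pmf (mpc_run k A r X) (\<lambda>T. map_pmf (\<lambda>Y. Y # T) (mpc_round k (A r) (hd T)))"

text \<open>The first sum is the memory of machine \<open>i\<close>, which is also the communication it has received;
  the second one is the communication it has sent.\<close>

definition within_space :: "nat \<Rightarrow> nat \<Rightarrow> mpc_state \<Rightarrow> bool" where
  "within_space k s X \<longleftrightarrow>
     (\<forall>i<k. (\<Sum>j<k. length (X i j)) \<le> s \<and> (\<Sum>j<k. length (X j i)) \<le> s)"

text \<open>\<open>f = \<O>~(g)\<close>, with logarithms of the size \<open>n + m\<close> of the hypergraph.\<close>

definition soft_O :: "(nat \<Rightarrow> nat \<Rightarrow> real) \<Rightarrow> (nat \<Rightarrow> nat \<Rightarrow> real) \<Rightarrow> bool" where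
  "soft_O f g \<longleftrightarrow>
     (\<exists>C p. \<forall>n m. \<bar>f n m\<bar> \<le> C * log 2 (real (n + m + 2)) ^ p * g n m)"


subsection \<open>Hyperedges as bit strings\<close>

text \<open>The vertices carry identifiers \<open>lab v < n\<close>. An edge is written as the sorted sequence of the
  identifiers of its vertices, each one with \<open>id_width n\<close> bits.\<close>

definition id_width :: "nat \<Rightarrow> nat" where
  "id_width n = nat \<lceil>log 2 (real n + 1)\<rceil>"

definition edge_bits :: "nat \<Rightarrow> ('a \<Rightarrow> nat) \<Rightarrow> 'a set \<Rightarrow> bool list" where
  "edge_bits n lab e =
     concat (map (\<lambda>x. map (bit x) [0..<id_width n]) (sorted_list_of_set (lab ` e)))"

definition edges_bits :: "nat \<Rightarrow> ('a \<Rightarrow> nat) \<Rightarrow> 'a set list \<Rightarrow> bool list" where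
  "edges_bits n lab es = concat (map (edge_bits n lab) es)"

text \<open>The input edges are distributed over the machines: machine \<open>j\<close> holds the list \<open>L j\<close>.\<close>

definition distributes :: "nat \<Rightarrow> 'a set set \<Rightarrow> (nat \<Rightarrow> 'a set list) \<Rightarrow> bool" where
  "distributes k E L \<longleftrightarrow>
     distinct (concat (map L [0..<k])) \<and> set (concat (map L [0..<k])) = E"

definition input_state ::
    "nat \<Rightarrow> ('a \<Rightarrow> nat) \<Rightarrow> (nat \<Rightarrow> 'a set list) \<Rightarrow> mpc_state" where
  "input_state n lab L = (\<lambda>j i. if i = j then edges_bits n lab (L j) else [])"

text \<open>The output \<open>M\<close> of a run consists of all edges stored on the machines in its last state; all
  that is stored then has to be lists of edges.\<close>

definition stores ::
    "nat \<Rightarrow> nat \<Rightarrow> 'a set \<Rightarrow> ('a \<Rightarrow> nat) \<Rightarrow> mpc_state \<Rightarrow> 'a set set \<Rightarrow> bool" where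
  "stores k d V lab X M \<longleftrightarrow>
     (\<exists>L. (\<forall>j<k. \<forall>i<k. X j i = edges_bits (card V) lab (L j i) \<and>
                       uniform_hypergraph d V (set (L j i))) \<and>
          M = (\<Union>j<k. \<Union>i<k. set (L j i)))"

text \<open>The algorithm \<open>A\<close> computes, in \<open>R\<close> rounds on \<open>k\<close> machines, an output with exactly the
  distribution of \<open>q\<close> (for \<open>stores\<close> relates a state to at most one set if \<open>d > 0\<close>). All space
  and communication bounds hold throughout the run with probability at least \<open>1 - \<delta>\<close>: the load
  of a machine is random, as it is assigned random edges.\<close>

definition mpc_implements ::
    "nat \<Rightarrow> nat \<Rightarrow> nat \<Rightarrow> real \<Rightarrow> mpc_algorithm \<Rightarrow> mpc_state \<Rightarrow>
     (mpc_state \<Rightarrow> 'b \<Rightarrow> bool) \<Rightarrow> 'b pmf \<Rightarrow> bool" where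
  "mpc_implements R k s \<delta> A X out q \<longleftrightarrow>
     rel_pmf (\<lambda>T M. out (hd T) M) (mpc_run k A R X) q \<and>
     measure_pmf.prob (mpc_run k A R X) {T. \<forall>Y\<in>set T. within_space k s Y} \<ge> 1 - \<delta>"

end

theory Submission
  imports Defs
begin

text \<open>Let \<open>T\<close> be a maximum matching of \<open>E\<close>. At step \<open>i\<close>, let \<open>O\<close> be a maximum matching among the
  edges of part \<open>i\<close> that meet the current matching \<open>M\<close>, and call the vertices of \<open>M\<close> and \<open>O\<close>
  blocked; there are at most \<open>d\<^sup>2 * card M\<close> of them. The edges of \<open>T\<close> in part \<open>i\<close> that avoid the
  blocked vertices extend \<open>O\<close> to a larger matching, so \<open>M\<close> grows at least by their number \<open>Y i\<close>.
  Whether such an edge lies in part \<open>i\<close> or in a later one does not influence the blocked set, so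
  the deviations of \<open>Y i\<close> from its conditional expectation are orthogonal, and Chebyshev's
  inequality applies to their sum over all steps (single steps need not concentrate, as \<open>k\<close> may
  be much larger than \<open>card T\<close>). Summing over the first third of the steps, where
  \<open>1 / (k - i) \<le> 3 / (2 * k)\<close>, gives \<open>card T \<le> (3 + 3 / 2 * d\<^sup>2) * card M\<close> up to a lower order term,
  and \<open>3 / 2 * d\<^sup>2 \<le> 3 * d * (d - 1)\<close> if \<open>d \<ge> 2\<close>.

  In the MPC implementation, the first round distributes the edges, the second one sends the
  maximum matchings to machine \<open>0\<close>, and the third one runs the greedy selection there.\<close>

section \<open>Random assignments\<close>

text \<open>The random map behind \<open>random_partition\<close>, kept as a function so that a
  single edge can be moved by \<open>fun_upd\<close>. Edges outside \<open>E\<close> take the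
  default value 0, which no part sees, as parts are subsets of \<open>E\<close>.\<close>

definition assignment :: "nat \<Rightarrow> 'e set \<Rightarrow> ('e \<Rightarrow> nat) pmf" where
  "assignment k E = Pi_pmf E 0 (\<lambda>_. pmf_of_set {..<k})"

lemma set_pmf_of_lessThan [simp]: "k > 0 \<Longrightarrow> set_pmf (pmf_of_set {..<k::nat}) = {..<k}"
  by (rule set_pmf_of_set) auto

lemma set_assignment:
  assumes "finite E" "k > 0"
  shows "set_pmf (assignment k E) = PiE_dflt E 0 (\<lambda>_. {..<k})"
  using assms by (auto simp: assignment_def set_Pi_pmf PiE_dflt_def)

lemma finite_set_assignment [simp, intro]:
  "finite E \<Longrightarrow> k > 0 \<Longrightarrow> finite (set_pmf (assignment k E))"
  by (auto simp: set_assignment)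

text \<open>The value at \<open>f\<close> is independent of the other values, so overwriting it by a
  fresh uniform one leaves the distribution unchanged.\<close>

lemma assignment_resample:
  assumes "finite E" "f \<in> E"
  shows "assignment k E =
    bind_pmf (assignment k E) (\<lambda>a. map_pmf (\<lambda>v. a(f := v)) (pmf_of_set {..<k}))"
proof -
  have E: "E = insert f (E - {f})" using assms by auto
  have A: "assignment k E = bind_pmf (pmf_of_set {..<k}) (\<lambda>y.
      bind_pmf (assignment k (E - {f})) (\<lambda>g. return_pmf (g(f := y))))"
    unfolding assignment_def by (subst E, subst Pi_pmf_insert') (use assms in auto)
  have upd: "fun_upd (g(f := x)) f = fun_upd g f" for g :: "'a \<Rightarrow> nat" and x
    by (rule ext) simp
  have "bind_pmf (assignment k E) (\<lambda>a. map_pmf (\<lambda>v. a(f := v)) (pmf_of_set {..<k}))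
      = bind_pmf (assignment k (E - {f})) (\<lambda>g. map_pmf (\<lambda>v. g(f := v)) (pmf_of_set {..<k}))"
    by (simp add: A bind_assoc_pmf bind_return_pmf upd)
  also have "\<dots> = assignment k E"
    unfolding A map_pmf_def by (rule bind_commute_pmf)
  finally show ?thesis ..
qed

text \<open>This takes the place of conditioning on all values except the one at \<open>f\<close>:
  an expectation can be bounded by bounding, for each fixed \<open>a\<close>, the average over the
  value at \<open>f\<close>.\<close>

lemma expectation_resample:
  fixes h :: "('e \<Rightarrow> nat) \<Rightarrow> real"
  assumes "finite E" "f \<in> E" "k > 0"
  shows "measure_pmf.expectation (assignment k E) h =
    measure_pmf.expectation (assignment k E) (\<lambda>a. (\<Sum>v<k. h (a(f := v))) / k)"
proof -
  let ?p = "assignment k E"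
  have "measure_pmf.expectation ?p h =
      measure_pmf.expectation (bind_pmf ?p (\<lambda>a. map_pmf (\<lambda>v. a(f := v)) (pmf_of_set {..<k}))) h"
    using assignment_resample[OF assms(1,2), of k] by simp
  also have "\<dots> = (\<Sum>a\<in>set_pmf ?p. pmf ?p a *\<^sub>R
      measure_pmf.expectation (map_pmf (\<lambda>v. a(f := v)) (pmf_of_set {..<k})) h)"
    using assms by (intro pmf_expectation_bind) auto
  also have "\<dots> = (\<Sum>a\<in>set_pmf ?p. pmf ?p a *\<^sub>R ((\<Sum>v<k. h (a(f := v))) / k))"
    using assms by (auto intro!: sum.cong simp: integral_pmf_of_set lessThan_empty_iff)
  also have "\<dots> = measure_pmf.expectation ?p (\<lambda>a. (\<Sum>v<k. h (a(f := v))) / k)"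
    using assms by (intro integral_measure_pmf[symmetric]) auto
  finally show ?thesis .
qed

text \<open>The cross terms vanish in the second moment of the sum, and Markov's inequality is
  applied to its square. Pairwise orthogonality suffices in place of independence.\<close>

lemma prob_orthogonal_sum_ge:
  fixes D :: "'j \<Rightarrow> 'b \<Rightarrow> real" and v :: real
  assumes fin: "finite (set_pmf p)" "finite J"
    and orth: "\<And>i j. i \<in> J \<Longrightarrow> j \<in> J \<Longrightarrow> i \<noteq> j \<Longrightarrow>
      measure_pmf.expectation p (\<lambda>x. D i x * D j x) = 0"
    and v: "\<And>j. j \<in> J \<Longrightarrow> measure_pmf.expectation p (\<lambda>x. (D j x)\<^sup>2) \<le> v"
    and y: "y > 0"
  shows "measure_pmf.prob p {x. y \<le> \<bar>\<Sum>j\<in>J. D j x\<bar>} \<le> card J * v / y\<^sup>2"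
proof -
  let ?S = "\<lambda>x. \<Sum>j\<in>J. D j x"
  have int: "integrable (measure_pmf p) g" for g :: "'b \<Rightarrow> real"
    using fin by (rule_tac integrable_measure_pmf_finite)
  have "measure_pmf.expectation p (\<lambda>x. (?S x)\<^sup>2) =
      (\<Sum>i\<in>J. \<Sum>j\<in>J. measure_pmf.expectation p (\<lambda>x. D i x * D j x))"
    by (simp add: power2_eq_square sum_product int Bochner_Integration.integral_sum)
  also have "\<dots> = (\<Sum>i\<in>J. \<Sum>j\<in>J. if i = j then measure_pmf.expectation p (\<lambda>x. (D j x)\<^sup>2) else 0)"
    by (intro sum.cong refl) (auto simp: orth power2_eq_square)
  also have "\<dots> = (\<Sum>i\<in>J. measure_pmf.expectation p (\<lambda>x. (D i x)\<^sup>2))"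
    using fin by simp
  also have "\<dots> \<le> card J * v"
    using sum_bounded_above[of J, OF v] by simp
  finally have E: "measure_pmf.expectation p (\<lambda>x. (?S x)\<^sup>2) \<le> card J * v" .
  have "{x. y \<le> \<bar>?S x\<bar>} = {x. (?S x)\<^sup>2 \<ge> y\<^sup>2}"
    using y by (simp add: abs_le_square_iff[symmetric])
  also have "measure_pmf.prob p \<dots> \<le> measure_pmf.expectation p (\<lambda>x. (?S x)\<^sup>2) / y\<^sup>2"
    using integral_Markov_inequality_measure[of "measure_pmf p" "\<lambda>x. (?S x)\<^sup>2" "{}" "y\<^sup>2"] int y
    by simp
  also have "\<dots> \<le> card J * v / y\<^sup>2"
    using E by (intro divide_right_mono) auto
  finally show ?thesis .
qed

section \<open>Matchings\<close>

lemma uniform_hypergraph_finite: "uniform_hypergraph d V E \<Longrightarrow> finite E"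
  by (rule finite_subset[of _ "Pow V"]) (auto simp: uniform_hypergraph_def)

lemma uniform_hypergraph_mono: "uniform_hypergraph d V E \<Longrightarrow> F \<subseteq> E \<Longrightarrow> uniform_hypergraph d V F"
  by (auto simp: uniform_hypergraph_def)

lemma is_matching_finite: "finite E \<Longrightarrow> is_matching E M \<Longrightarrow> finite M"
  by (auto simp: is_matching_def intro: finite_subset)

lemma finite_matchings: "finite E \<Longrightarrow> finite {M. is_matching E M}"
  by (rule finite_subset[of _ "Pow E"]) (auto simp: is_matching_def)

lemma card_le_matching_number:
  "finite E \<Longrightarrow> is_matching E M \<Longrightarrow> card M \<le> matching_number E"
  unfolding matching_number_def by (intro Max_ge) (auto simp: finite_matchings)

lemma maximum_matching_exists:
  assumes "finite E"
  obtains M where "is_maximum_matching E M"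
proof -
  have "is_matching E {}" by (simp add: is_matching_def)
  then have "matching_number E \<in> card ` {M. is_matching E M}"
    unfolding matching_number_def using finite_matchings[OF assms] by (intro Max_in) auto
  then show ?thesis using that by (auto simp: is_maximum_matching_def)
qed

lemma matching_number_le_card:
  assumes "finite E" shows "matching_number E \<le> card E"
proof -
  obtain M where "is_maximum_matching E M" using maximum_matching_exists[OF assms] .
  then show ?thesis
    using assms by (metis card_mono is_matching_def is_maximum_matching_def)
qed

text \<open>Choosing a point of \<open>X\<close> in each member of \<open>S\<close> is injective,
  because the members are disjoint.\<close>

lemma card_le_of_pairwise_disjnt_meets:
  assumes "pairwise disjnt S" "finite X" "\<And>e. e \<in> S \<Longrightarrow> e \<inter> X \<noteq> {}"
  shows "finite S" "card S \<le> card X"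
proof -
  define g where "g e = (SOME x. x \<in> e \<inter> X)" for e
  have g: "g e \<in> e \<inter> X" if "e \<in> S" for e
    using assms(3)[OF that] unfolding g_def by (rule some_in_eq[THEN iffD2])
  have inj: "inj_on g S"
  proof (rule inj_onI, rule ccontr)
    fix e f assume "e \<in> S" "f \<in> S" "g e = g f" "e \<noteq> f"
    then show False
      using pairwiseD[OF assms(1), of e f] g[of e] g[of f] by (auto simp: disjnt_def)
  qed
  have sub: "g ` S \<subseteq> X" using g by auto
  show "finite S" using inj sub assms(2) by (metis finite_imageD finite_subset)
  show "card S \<le> card X" using inj sub assms(2) by (rule card_inj_on_le)
qed

lemma greedy_cong: "(\<And>j. j < i \<Longrightarrow> N j = N' j) \<Longrightarrow> greedy N i = greedy N' i"
  by (induction i) auto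

lemma greedy_subset: "greedy N i \<subseteq> (\<Union>j<i. N j)"
  by (induction i) (auto simp: greedy_step_def lessThan_Suc)

lemma greedy_mono: "i \<le> j \<Longrightarrow> greedy N i \<subseteq> greedy N j"
  by (induction j) (auto simp: greedy_step_def le_Suc_eq)

lemma pairwise_disjnt_greedy:
  assumes "\<And>j. j < i \<Longrightarrow> pairwise disjnt (N j)"
  shows "pairwise disjnt (greedy N i)"
  using assms
proof (induction i)
  case (Suc i)
  then show ?case
    using greedy_step_unique_maximal[of "greedy N i" "N i" "greedy N (Suc i)"] by simp
qed simp

text \<open>The union of \<open>S\<close> and \<open>R\<close> is a matching, so the maximum matching \<open>N\<close> has at least
  \<open>card S + card R\<close> edges; at most \<open>card R\<close> of them meet \<open>M\<close>.\<close>

lemma greedy_step_gain: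
  assumes d: "d \<ge> 1" and F: "uniform_hypergraph d V F"
    and N: "is_maximum_matching F N"
    and M: "finite M"
    and R: "is_maximum_matching {e\<in>F. e \<inter> \<Union>M \<noteq> {}} R"
    and S: "is_matching F S" and SB: "\<And>e. e \<in> S \<Longrightarrow> e \<inter> (\<Union>M \<union> \<Union>R) = {}"
  shows "card M + card S \<le> card (greedy_step M N)"
proof -
  define A where "A = {e\<in>N. e \<inter> \<Union>M = {}}"
  have fin: "finite F" using F by (rule uniform_hypergraph_finite)
  have NF: "N \<subseteq> F" "pairwise disjnt N" "card N = matching_number F"
    using N by (auto simp: is_maximum_matching_def is_matching_def)
  have finN: "finite N" using NF fin finite_subset by blast
  have RF: "R \<subseteq> F" "pairwise disjnt R" using R by (auto simp: is_maximum_matching_def is_matching_def)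
  have SF: "S \<subseteq> F" "pairwise disjnt S" using S by (auto simp: is_matching_def)
  have finO: "finite R" "finite S" using RF SF fin finite_subset by blast+
  have ne: "e \<noteq> {}" if "e \<in> F" for e
    using that F d by (auto simp: uniform_hypergraph_def)
  have dSR: "disjnt e f" if "e \<in> S" "f \<in> R" for e f
    using SB[OF that(1)] that(2) by (auto simp: disjnt_def)
  \<comment> \<open>The empty set is disjoint from itself; here \<open>d \<ge> 1\<close> enters, as
    it makes all edges nonempty.\<close>
  have SO: "S \<inter> R = {}"
    using dSR ne SF(1) by (metis IntE disjnt_self_iff_empty equals0I subsetD)
  have "pairwise disjnt (S \<union> R)"
    using SF(2) RF(2) dSR unfolding pairwise_def by (metis UnE disjnt_sym)
  then have "card (S \<union> R) \<le> card N"
    using NF card_le_matching_number[OF fin] SF RF by (simp add: is_matching_def)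
  then have 1: "card S + card R \<le> card N"
    using finO SO by (simp add: card_Un_disjoint)
  have "is_matching {e\<in>F. e \<inter> \<Union>M \<noteq> {}} (N - A)"
    using NF unfolding A_def is_matching_def by (auto intro: pairwise_mono)
  then have "card (N - A) \<le> card R"
    using R fin card_le_matching_number[of "{e\<in>F. e \<inter> \<Union>M \<noteq> {}}" "N - A"]
    by (simp add: is_maximum_matching_def)
  moreover have "card N = card A + card (N - A)"
    using finN card_Un_disjoint[of A "N - A"] by (auto simp: A_def Un_absorb1)
  ultimately have 2: "card S \<le> card A" using 1 by linarith
  have "M \<inter> A = {}"
  proof -
    have "e = {}" if "e \<in> M" "e \<in> A" for e
      using that by (auto simp: A_def)
    moreover have "e \<noteq> {}" if "e \<in> A" for e
      using that ne NF(1) by (auto simp: A_def)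
    ultimately show ?thesis by blast
  qed
  moreover have "greedy_step M N = M \<union> A"
    by (auto simp: greedy_step_def A_def disjnt_def)
  ultimately show ?thesis
    using 2 M finN by (simp add: A_def card_Un_disjoint)
qed

lemma card_Union_uniform_le:
  assumes "uniform_hypergraph d V F" "M \<subseteq> F"
  shows "card (\<Union>M) \<le> d * card M"
proof -
  have "card (\<Union>M) \<le> (\<Sum>e\<in>M. card e)"
    by (rule card_Union_le_sum_card)
  also have "\<dots> \<le> (\<Sum>e\<in>M. d)"
    using assms by (intro sum_mono) (auto simp: uniform_hypergraph_def)
  finally show ?thesis by (simp add: mult.commute)
qed

text \<open>By disjointness \<open>R\<close> has at most \<open>card X\<close> edges, and each of
  them brings at most \<open>d - 1\<close> vertices outside \<open>X\<close>; this gives the factor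
  \<open>1 + (d - 1)\<close>.\<close>

lemma card_Un_matching_le:
  assumes d: "d \<ge> 1" and F: "uniform_hypergraph d V F" and R: "R \<subseteq> F" "pairwise disjnt R"
    and X: "finite X" and OX: "\<And>e. e \<in> R \<Longrightarrow> e \<inter> X \<noteq> {}"
  shows "card (X \<union> \<Union>R) \<le> d * card X"
proof -
  have finO: "finite R" "card R \<le> card X"
    using card_le_of_pairwise_disjnt_meets[OF R(2) X OX] by auto
  have e: "card (e - X) \<le> d - 1" if "e \<in> R" for e
  proof -
    have fe: "finite e" "card e = d"
      using that F R by (auto simp: uniform_hypergraph_def intro: finite_subset)
    then have "e - X \<subset> e" using OX[OF that] by auto
    then have "card (e - X) < d" using psubset_card_mono fe by blast
    then show ?thesis by simp
  qed
  have "X \<union> \<Union>R = X \<union> (\<Union>e\<in>R. e - X)" by auto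
  then have "card (X \<union> \<Union>R) \<le> card X + card (\<Union>e\<in>R. e - X)"
    by (metis card_Un_le)
  also have "card (\<Union>e\<in>R. e - X) \<le> (\<Sum>e\<in>R. card (e - X))"
    by (rule card_UN_le[OF finO(1)])
  also have "\<dots> \<le> card R * (d - 1)"
    using sum_bounded_above[of R "\<lambda>e. card (e - X)" "d - 1"] e by simp
  also have "\<dots> \<le> card X * (d - 1)" using finO by simp
  also have "card X + card X * (d - 1) = d * card X"
    using d by (cases d) auto
  finally show ?thesis by simp
qed

section \<open>Approximation ratio\<close>

locale greedy_run =
  fixes d k :: nat and V :: "'a set" and E T :: "'a set set"
    and MM :: "nat \<Rightarrow> 'a set set \<Rightarrow> 'a set set"
  assumes d: "d \<ge> 1" and k: "k > 0"
    and E: "uniform_hypergraph d V E"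
    and MM: "maximum_matching_rule d V MM"
    and T: "is_matching E T"
begin

definition part :: "('a set \<Rightarrow> nat) \<Rightarrow> nat \<Rightarrow> 'a set set" where
  "part a i = {e\<in>E. a e = i}"

text \<open>The matching held before part \<open>i\<close> is processed: it depends only on the
  parts below \<open>i\<close>, and \<open>cur a k\<close> is the output.\<close>

definition cur :: "('a set \<Rightarrow> nat) \<Rightarrow> nat \<Rightarrow> 'a set set" where
  "cur a i = greedy (\<lambda>j. MM j (part a j)) i"

text \<open>The analysis also applies the rule \<open>MM i\<close> to this set, although the
  algorithm does not: this yields a maximum matching that is a function of the set alone.\<close>

definition old :: "('a set \<Rightarrow> nat) \<Rightarrow> nat \<Rightarrow> 'a set set" where
  "old a i = {e\<in>part a i. e \<inter> \<Union>(cur a i) \<noteq> {}}"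

text \<open>An edge of part \<open>i\<close> that avoids \<open>cur a i\<close> has no influence on \<open>blocked a i\<close>.\<close>

definition blocked :: "('a set \<Rightarrow> nat) \<Rightarrow> nat \<Rightarrow> 'a set" where
  "blocked a i = \<Union>(cur a i) \<union> \<Union>(MM i (old a i))"

text \<open>Given \<open>i \<le> a e\<close>, the edge \<open>e\<close> is in part \<open>i\<close> with probability \<open>1 / (k - i)\<close>.\<close>

definition dev :: "'a set \<times> nat \<Rightarrow> ('a set \<Rightarrow> nat) \<Rightarrow> real" where
  "dev = (\<lambda>(e, i) a. if i \<le> a e \<and> e \<inter> blocked a i = {}
     then of_bool (a e = i) - 1 / real (k - i) else 0)"

lemma finE: "finite E" using E by (rule uniform_hypergraph_finite)

lemma part_subset: "part a i \<subseteq> E" by (auto simp: part_def)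

lemma MM_maximum: "F \<subseteq> E \<Longrightarrow> is_maximum_matching F (MM i F)"
  using MM uniform_hypergraph_mono[OF E] by (auto simp: maximum_matching_rule_def)

lemma MM_subset: "F \<subseteq> E \<Longrightarrow> MM i F \<subseteq> F"
  using MM_maximum by (auto simp: is_maximum_matching_def is_matching_def)

lemma cur_matching: "is_matching E (cur a i)"
  unfolding is_matching_def
proof
  show "cur a i \<subseteq> E"
    unfolding cur_def
    by (rule subset_trans[OF greedy_subset])
       (intro UN_least subset_trans[OF MM_subset[OF part_subset] part_subset])
  show "pairwise disjnt (cur a i)"
    unfolding cur_def using MM_maximum[OF part_subset]
    by (intro pairwise_disjnt_greedy) (auto simp: is_maximum_matching_def is_matching_def)
qed

lemma finite_cur: "finite (cur a i)"
  using cur_matching finE by (rule is_matching_finite[rotated])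

section \<open>Effect of moving a single edge, and orthogonality of the deviations\<close>

lemma part_upd: "j < v \<Longrightarrow> j < v' \<Longrightarrow> part (a(f := v)) j = part (a(f := v')) j"
  by (auto simp: part_def)

text \<open>Only the parts below \<open>i\<close> enter \<open>cur a i\<close>, and \<open>f\<close>
  lies in none of them, before or after the move.\<close>

lemma cur_upd:
  assumes "i \<le> v" "i \<le> v'" shows "cur (a(f := v)) i = cur (a(f := v')) i"
  unfolding cur_def
proof (rule greedy_cong)
  fix j assume "j < i"
  then have "part (a(f := v)) j = part (a(f := v')) j"
    using assms by (intro part_upd) auto
  then show "MM j (part (a(f := v)) j) = MM j (part (a(f := v')) j)" by simp
qed

lemma blocked_upd_greater:
  assumes "i < v" "i < v'" shows "blocked (a(f := v)) i = blocked (a(f := v')) i"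
  unfolding blocked_def old_def
  by (simp only: cur_upd[OF assms[THEN less_imp_le]] part_upd[OF assms])

text \<open>The case that matters is a move of \<open>f\<close> between part \<open>i\<close> and a
  later one. As \<open>f\<close> avoids the current matching, it does not belong to
  \<open>old\<close> even when it lies in part \<open>i\<close>, so \<open>old\<close> and its
  maximum matching stay the same.\<close>

lemma blocked_upd_avoid:
  assumes "i \<le> v" "i \<le> v'" "f \<inter> blocked (a(f := v)) i = {}"
  shows "blocked (a(f := v)) i = blocked (a(f := v')) i"
proof -
  have c: "cur (a(f := v)) i = cur (a(f := v')) i" by (rule cur_upd[OF assms(1,2)])
  moreover have "f \<inter> \<Union>(cur (a(f := v)) i) = {}" using assms(3) unfolding blocked_def by blast
  ultimately have "old (a(f := v)) i = old (a(f := v')) i"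
    unfolding old_def part_def by (intro Collect_cong) auto
  then show ?thesis unfolding blocked_def c by simp
qed

text \<open>The factor \<open>G\<close> plays the role of information available before it is
  revealed whether \<open>f\<close> falls into part \<open>i\<close>. Among the \<open>k - i\<close>
  values from \<open>i\<close> on, \<open>dev\<close> is \<open>1 - 1 / (k - i)\<close> once and
  \<open>- 1 / (k - i)\<close> otherwise, so the average over the value at \<open>f\<close> is
  0.\<close>

lemma expectation_mult_dev_eq_0:
  assumes f: "f \<in> E" and i: "i < k"
    and G: "\<And>a v v'. i \<le> v \<Longrightarrow> i \<le> v' \<Longrightarrow> f \<inter> blocked (a(f := v)) i = {} \<Longrightarrow>
      G (a(f := v)) = G (a(f := v'))"
  shows "measure_pmf.expectation (assignment k E) (\<lambda>a. G a * dev (f, i) a) = 0"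
proof -
  have "(\<Sum>v<k. G (a(f := v)) * dev (f, i) (a(f := v))) = 0" for a
  \<comment> \<open>Whether \<open>f\<close> avoids the blocked set is the same for all values from
    \<open>i\<close> on, so testing it at the value \<open>i\<close> settles all terms at
    once.\<close>
  proof (cases "f \<inter> blocked (a(f := i)) i = {}")
    case True
    have pt: "G (a(f := v)) * dev (f, i) (a(f := v)) =
      G (a(f := i)) * (of_bool (v = i) - 1 / real (k - i))" if "i \<le> v" for v
    proof -
      have "blocked (a(f := i)) i = blocked (a(f := v)) i"
        using blocked_upd_avoid[of i i v f a] True that by simp
      moreover have "G (a(f := i)) = G (a(f := v))" using G[of i v a] True that by simp
      ultimately show ?thesis using True that by (simp add: dev_def)
    qed
    have "(\<Sum>v<k. G (a(f := v)) * dev (f, i) (a(f := v))) =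
        (\<Sum>v\<in>{i..<k}. G (a(f := v)) * dev (f, i) (a(f := v)))"
      by (rule sum.mono_neutral_right) (auto simp: dev_def)
    moreover have "\<dots> = (\<Sum>v\<in>{i..<k}. G (a(f := i)) * (of_bool (v = i) - 1 / real (k - i)))"
      by (rule sum.cong[OF refl]) (rule pt, simp)
    moreover have "\<dots> = G (a(f := i)) * (\<Sum>v\<in>{i..<k}. of_bool (v = i) - 1 / real (k - i))"
      by (rule sum_distrib_left[symmetric])
    moreover have "(\<Sum>v\<in>{i..<k}. of_bool (v = i) - 1 / real (k - i)) = 0"
      using i by (simp add: sum_subtractf of_bool_def)
    ultimately show ?thesis by (metis mult_zero_right)
  next
    case False
    have "dev (f, i) (a(f := v)) = 0" for v
    proof (rule ccontr)
      assume "dev (f, i) (a(f := v)) \<noteq> 0"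
      then have v: "i \<le> v" "f \<inter> blocked (a(f := v)) i = {}"
        by (simp_all add: dev_def split: if_splits)
      then show False
        using blocked_upd_avoid[OF v(1) order_refl v(2)] False by simp
    qed
    then show ?thesis by simp
  qed
  then show ?thesis
    by (subst expectation_resample[OF finE f k]) simp
qed

text \<open>The later factor is averaged out, and the earlier one takes the place of
  \<open>G\<close>. If \<open>e = f\<close>, then \<open>i < j\<close>, so the values compared both
  exceed \<open>i\<close> and the indicator in \<open>dev (e, i)\<close> is 0 for both; if
  \<open>e \<noteq> f\<close>, only the blocked set could change, and it does not.\<close>

lemma dev_orthogonal_less:
  assumes "f \<in> E" "i \<le> j" "j < k" "(e, i) \<noteq> (f, j)"
  shows "measure_pmf.expectation (assignment k E) (\<lambda>a. dev (e, i) a * dev (f, j) a) = 0"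
proof (rule expectation_mult_dev_eq_0[OF assms(1,3)])
  fix a v v' assume v: "j \<le> v" "j \<le> v'" "f \<inter> blocked (a(f := v)) j = {}"
  have "blocked (a(f := v)) i = blocked (a(f := v')) i"
  proof (cases "i = j")
    case True
    then show ?thesis using blocked_upd_avoid[OF v] by simp
  next
    case False
    then show ?thesis using assms v by (intro blocked_upd_greater) auto
  qed
  then show "dev (e, i) (a(f := v)) = dev (e, i) (a(f := v'))"
    using assms v by (auto simp: dev_def)
qed

lemma dev_orthogonal:
  assumes "e \<in> E" "f \<in> E" "i < k" "j < k" "(e, i) \<noteq> (f, j)"
  shows "measure_pmf.expectation (assignment k E) (\<lambda>a. dev (e, i) a * dev (f, j) a) = 0"
proof (cases "i \<le> j")
  case True
  then show ?thesis using assms by (intro dev_orthogonal_less)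
next
  case False
  then show ?thesis
    using dev_orthogonal_less[of e j i f] assms by (simp add: mult.commute)
qed

text \<open>The square is at most \<open>1 + 1 / (k - i)\<close> if \<open>f\<close> falls into part
  \<open>i\<close>, and at most \<open>1 / (k - i)\<close> if it falls later; each of the two
  contributions averages to \<open>1 / k\<close>. The order \<open>1 / k\<close> keeps the total
  over up to \<open>k\<close> steps bounded by a constant for each edge.\<close>

lemma dev_second_moment:
  assumes "f \<in> E" "i < k"
  shows "measure_pmf.expectation (assignment k E) (\<lambda>a. (dev (f, i) a)\<^sup>2) \<le> 2 / k"
proof -
  let ?r = "real (k - i)"
  have r: "?r \<ge> 1" using assms by linarith
  have "(dev (f, i) a)\<^sup>2 \<le> of_bool (a f = i) + of_bool (i \<le> a f) / ?r" for a
  proof -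
    have aux: "(1 - q)\<^sup>2 \<le> 1 + q" if "q \<ge> 0" "q\<^sup>2 \<le> q" for q :: real
      using that by (simp add: power2_diff)
    have q: "(1 / ?r)\<^sup>2 \<le> 1 / ?r"
      using r power_decreasing[of 1 2 "1 / ?r"] by simp
    moreover have "(1 - 1 / ?r)\<^sup>2 \<le> 1 + 1 / ?r"
      by (intro aux[OF _ q]) simp
    ultimately show ?thesis by (auto simp: dev_def power2_commute)
  qed
  then have "(\<Sum>v<k. (dev (f, i) (a(f := v)))\<^sup>2) \<le>
      (\<Sum>v<k. of_bool (v = i) + of_bool (i \<le> v) / ?r)" for a
    by (intro sum_mono) (metis fun_upd_same)
  also have "(\<Sum>v<k. of_bool (v = i) + of_bool (i \<le> v) / ?r) = 2"
  proof -
    have "(\<Sum>v<k. of_bool (v = i) :: real) = 1" using assms by (simp add: of_bool_def)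
    moreover have "(\<Sum>v<k. of_bool (i \<le> v) :: real) = ?r"
    proof -
      have "{..<k} \<inter> {v. i \<le> v} = {i..<k}" by auto
      then show ?thesis by (simp add: sum_of_bool_eq)
    qed
    ultimately show ?thesis using r by (simp add: sum.distrib sum_divide_distrib[symmetric])
  qed
  finally have *: "(\<Sum>v<k. (dev (f, i) (a(f := v)))\<^sup>2) \<le> 2" for a .
  have "measure_pmf.expectation (assignment k E) (\<lambda>a. (dev (f, i) a)\<^sup>2) =
      measure_pmf.expectation (assignment k E) (\<lambda>a. (\<Sum>v<k. (dev (f, i) (a(f := v)))\<^sup>2) / k)"
    by (rule expectation_resample[OF finE assms(1) k])
  also have "\<dots> \<le> measure_pmf.expectation (assignment k E) (\<lambda>a. 2 / k)"
    using * finE k by (intro integral_mono integrable_measure_pmf_finite)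
      (auto intro!: divide_right_mono)
  finally show ?thesis by simp
qed

section \<open>The first third of the steps and the hazard sums\<close>

definition horizon :: nat where "horizon = (k + 2) div 3"

text \<open>\<open>hazard (a e)\<close> adds up the conditional probabilities \<open>1 / (k - i)\<close> of \<open>e\<close> falling into
  part \<open>i\<close> over the first \<open>horizon\<close> steps in which it is still unassigned.\<close>

definition hazard :: "nat \<Rightarrow> real" where
  "hazard v = (\<Sum>i<horizon. of_bool (i \<le> v) / real (k - i))"

text \<open>\<open>horizon\<close> is \<open>k / 3\<close> rounded up, so that it covers at least a
  third of the steps, which leads to the constant 3 in the ratio; still, \<open>i < horizon\<close>
  implies \<open>3 * i < k\<close>, which leads to the factor \<open>3 / 2\<close>.\<close>

lemma horizon: "k \<le> 3 * horizon" "horizon \<le> k" "horizon > 0"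
  using k by (auto simp: horizon_def)

lemma inverse_remaining_le:
  assumes "i < horizon" shows "1 / real (k - i) \<le> 3 / (2 * real k)"
proof -
  have "2 * k \<le> 3 * (k - i)" "i < k" using assms k by (auto simp: horizon_def)
  then have "2 * real k \<le> 3 * real (k - i)" "real (k - i) > 0" by linarith+
  then show ?thesis using k by (simp add: field_simps)
qed

lemma hazard_bounds: "0 \<le> hazard v" "hazard v \<le> 3 / 2"
proof -
  show "0 \<le> hazard v" unfolding hazard_def by (intro sum_nonneg) auto
  have "hazard v \<le> (\<Sum>i<horizon. 3 / (2 * real k))"
    unfolding hazard_def using inverse_remaining_le by (intro sum_mono) (auto simp: of_bool_def)
  also have "\<dots> = real horizon * 3 / (2 * real k)" by simp
  also have "\<dots> \<le> 3 / 2" using horizon(2) k by (simp add: field_simps)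
  finally show "hazard v \<le> 3 / 2" .
qed

text \<open>After exchanging the sums, each step \<open>i\<close> contributes \<open>k - i\<close>
  times \<open>1 / (k - i)\<close>. Hence \<open>horizon / k\<close> is the mean of
  \<open>hazard\<close> at a uniform value.\<close>

lemma sum_hazard: "(\<Sum>v<k. hazard v) = horizon"
proof -
  have "(\<Sum>v<k. hazard v) = (\<Sum>i<horizon. \<Sum>v<k. of_bool (i \<le> v) / real (k - i))"
    unfolding hazard_def by (rule sum.swap)
  also have "\<dots> = (\<Sum>i<horizon. 1)"
  proof (rule sum.cong[OF refl])
    fix i assume "i \<in> {..<horizon}"
    then have i: "i < k" using horizon by auto
    have "{..<k} \<inter> {v. i \<le> v} = {i..<k}" by auto
    then have "(\<Sum>v<k. of_bool (i \<le> v) :: real) = real (k - i)" by (simp add: sum_of_bool_eq)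
    then show "(\<Sum>v<k. of_bool (i \<le> v) / real (k - i)) = 1"
      using i by (simp add: sum_divide_distrib[symmetric])
  qed
  finally show ?thesis by simp
qed

definition hazard_dev :: "'a set \<Rightarrow> ('a set \<Rightarrow> nat) \<Rightarrow> real" where
  "hazard_dev e a = hazard (a e) - horizon / k"

text \<open>Redrawing the value at \<open>f\<close> leaves the factor of \<open>e\<close> fixed and
  averages the centred factor of \<open>f\<close> to 0.\<close>

lemma hazard_dev_orthogonal:
  assumes "f \<in> E" "e \<noteq> f"
  shows "measure_pmf.expectation (assignment k E) (\<lambda>a. hazard_dev e a * hazard_dev f a) = 0"
proof -
  have "(\<Sum>v<k. hazard_dev e (a(f := v)) * hazard_dev f (a(f := v))) = 0" for a
  proof -
    have "(\<Sum>v<k. hazard_dev e (a(f := v)) * hazard_dev f (a(f := v))) =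
        hazard_dev e a * (\<Sum>v<k. hazard v - horizon / k)"
      using assms by (simp add: hazard_dev_def sum_distrib_left)
    moreover have "(\<Sum>v<k. hazard v - horizon / k) = 0"
      using k by (simp add: sum_subtractf sum_hazard)
    ultimately show ?thesis by (metis mult_zero_right)
  qed
  then show ?thesis by (subst expectation_resample[OF finE assms(1) k]) simp
qed

text \<open>Both \<open>hazard\<close> and its mean lie between 0 and \<open>3 / 2\<close>, so they
  differ by at most \<open>3 / 2\<close>.\<close>

lemma hazard_dev_second_moment:
  "measure_pmf.expectation (assignment k E) (\<lambda>a. (hazard_dev e a)\<^sup>2) \<le> 9 / 4"
proof -
  have "(hazard_dev e a)\<^sup>2 \<le> (3 / 2)\<^sup>2" for a
  proof -
    have "0 \<le> real horizon / real k" "real horizon / real k \<le> 3 / 2"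
      using horizon k by (simp_all add: field_simps)
    then have "\<bar>hazard_dev e a\<bar> \<le> \<bar>3 / 2\<bar>"
      using hazard_bounds[of "a e"] unfolding hazard_dev_def by linarith
    then show ?thesis by (simp only: abs_le_square_iff)
  qed
  then have "measure_pmf.expectation (assignment k E) (\<lambda>a. (hazard_dev e a)\<^sup>2) \<le>
      measure_pmf.expectation (assignment k E) (\<lambda>a. (3 / 2)\<^sup>2)"
    using finE k by (intro integral_mono integrable_measure_pmf_finite) auto
  then show ?thesis by (simp add: power2_eq_square)
qed

section \<open>Growth of the greedy matching compared with \<open>T\<close>\<close>

lemma finT: "finite T" using is_matching_finite[OF finE T] .

lemma T_subset: "T \<subseteq> E" using T by (simp add: is_matching_def)

lemma card_cur_mono: "i \<le> j \<Longrightarrow> card (cur a i) \<le> card (cur a j)"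
  using greedy_mono finite_cur unfolding cur_def by (intro card_mono) auto

text \<open>This is \<open>greedy_step_gain\<close> with the maximum matching of
  \<open>old a i\<close> as \<open>R\<close> and the unblocked edges of \<open>T\<close> in part
  \<open>i\<close> as \<open>S\<close>.\<close>

lemma card_cur_Suc_ge:
  "card (cur a i) + card {e\<in>T. a e = i \<and> e \<inter> blocked a i = {}} \<le> card (cur a (Suc i))"
proof -
  have "card (cur a i) + card {e\<in>T. a e = i \<and> e \<inter> blocked a i = {}}
      \<le> card (greedy_step (cur a i) (MM i (part a i)))"
  proof (rule greedy_step_gain[OF d uniform_hypergraph_mono[OF E part_subset]])
    show "is_maximum_matching (part a i) (MM i (part a i))"
      by (rule MM_maximum[OF part_subset])
    show "is_maximum_matching {e\<in>part a i. e \<inter> \<Union>(cur a i) \<noteq> {}} (MM i (old a i))"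
      unfolding old_def using part_subset by (intro MM_maximum) auto
    show "is_matching (part a i) {e\<in>T. a e = i \<and> e \<inter> blocked a i = {}}"
      using T unfolding is_matching_def part_def by (auto intro: pairwise_mono)
  qed (auto simp: finite_cur blocked_def)
  then show ?thesis by (simp add: cur_def)
qed

text \<open>One factor \<open>d\<close> counts the vertices of the current matching; the other one
  comes from \<open>card_Un_matching_le\<close>, applied with these vertices as
  \<open>X\<close>.\<close>

lemma card_blocked_le: "finite (blocked a i)" "card (blocked a i) \<le> d\<^sup>2 * card (cur a i)"
proof -
  have c: "cur a i \<subseteq> E" using cur_matching by (auto simp: is_matching_def)
  have old: "is_maximum_matching (old a i) (MM i (old a i))"
    using part_subset by (intro MM_maximum) (auto simp: old_def)
  have oldE: "MM i (old a i) \<subseteq> E" "MM i (old a i) \<subseteq> old a i" "pairwise disjnt (MM i (old a i))"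
    using old part_subset by (auto simp: is_maximum_matching_def is_matching_def old_def)
  have "\<Union>E \<subseteq> V" "finite V" using E by (auto simp: uniform_hypergraph_def)
  then have finU: "finite (\<Union>F)" if "F \<subseteq> E" for F
    by (meson Union_mono that finite_subset)
  show "finite (blocked a i)" unfolding blocked_def using finU c oldE by simp
  have "card (blocked a i) \<le> d * card (\<Union>(cur a i))"
    unfolding blocked_def
    by (rule card_Un_matching_le[OF d E oldE(1,3) finU[OF c]])
       (use oldE in \<open>auto simp: old_def\<close>)
  also have "\<dots> \<le> d * (d * card (cur a i))"
    using card_Union_uniform_le[OF E c] by simp
  finally show "card (blocked a i) \<le> d\<^sup>2 * card (cur a i)"
    by (simp add: power2_eq_square mult.assoc)
qed

text \<open>For an unblocked edge, \<open>dev\<close> plus the hazard term equals the indicator of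
  falling into part \<open>i\<close>. A blocked edge has \<open>dev\<close> equal to 0 and costs at
  most \<open>1 / (k - i)\<close>; as \<open>T\<close> is a matching, there are at most as many
  blocked edges as blocked vertices. The final matching replaces the current one to make the error
  uniform in \<open>i\<close>.\<close>

lemma card_avoiding_ge:
  assumes "i < horizon"
  shows "real (card {e\<in>T. a e = i \<and> e \<inter> blocked a i = {}}) \<ge>
    (\<Sum>e\<in>T. dev (e, i) a) + (\<Sum>e\<in>T. of_bool (i \<le> a e) / real (k - i))
      - real (d\<^sup>2 * card (cur a k)) * (3 / (2 * real k))"
proof -
  let ?r = "real (k - i)"
  let ?B = "{e\<in>T. e \<inter> blocked a i \<noteq> {}}"
  have i: "i < k" using assms horizon by auto
  have "card ?B \<le> card (blocked a i)"
    using T card_blocked_le(1)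
    by (intro card_le_of_pairwise_disjnt_meets(2))
       (auto simp: is_matching_def intro: pairwise_mono)
  also have "\<dots> \<le> d\<^sup>2 * card (cur a i)" by (rule card_blocked_le)
  also have "\<dots> \<le> d\<^sup>2 * card (cur a k)" using card_cur_mono i by simp
  finally have B: "real (card ?B) \<le> real (d\<^sup>2 * card (cur a k))" by (simp only: of_nat_le_iff)
  have "(\<Sum>e\<in>T. dev (e, i) a) + (\<Sum>e\<in>T. of_bool (i \<le> a e) / ?r) \<le>
      (\<Sum>e\<in>T. of_bool (a e = i \<and> e \<inter> blocked a i = {}) + of_bool (e \<inter> blocked a i \<noteq> {}) * (1 / ?r))"
    unfolding sum.distrib[symmetric] by (intro sum_mono) (auto simp: dev_def)
  also have "\<dots> = card {e\<in>T. a e = i \<and> e \<inter> blocked a i = {}} + card ?B * (1 / ?r)"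
    unfolding sum.distrib sum_distrib_right[symmetric] using finT
    by (simp add: sum_of_bool_eq Int_def)
  also have "card ?B * (1 / ?r) \<le> real (d\<^sup>2 * card (cur a k)) * (3 / (2 * real k))"
    using B inverse_remaining_le[OF assms] by (intro mult_mono) auto
  finally show ?thesis by simp
qed

text \<open>This holds for every assignment; randomness enters only through the two deviation sums.
  The gains of the first \<open>horizon\<close> steps add up to at most the final size, while the
  hazard terms add up to \<open>card T * (horizon / k)\<close> plus the sum of
  \<open>hazard_dev\<close>. Dividing by \<open>horizon / k\<close>, which is at least
  \<open>1 / 3\<close>, gives the constants.\<close>

lemma card_T_le:
  "real (card T) \<le> (3 + 3 / 2 * (real d)\<^sup>2) * real (card (cur a k)) +
    3 * (\<bar>\<Sum>p\<in>T \<times> {..<horizon}. dev p a\<bar> + \<bar>\<Sum>e\<in>T. hazard_dev e a\<bar>)"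
proof -
  let ?Y = "\<lambda>i. card {e\<in>T. a e = i \<and> e \<inter> blocked a i = {}}"
  let ?g = "real (card (cur a k))" and ?t = "real horizon"
  let ?S = "\<Sum>p\<in>T \<times> {..<horizon}. dev p a" and ?Z = "\<Sum>e\<in>T. hazard_dev e a"
  define c where "c = real (d\<^sup>2 * card (cur a k)) * (3 / (2 * real k))"
  have "(\<Sum>i<j. ?Y i) \<le> card (cur a j)" for j
  proof (induction j)
    case (Suc j)
    then show ?case using card_cur_Suc_ge[of a j] by simp
  qed simp
  then have "(\<Sum>i<horizon. ?Y i) \<le> card (cur a k)"
    using card_cur_mono[OF horizon(2)] le_trans by blast
  then have g: "(\<Sum>i<horizon. real (?Y i)) \<le> ?g"
    by (simp only: of_nat_sum[symmetric] of_nat_le_iff)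
  have "(\<Sum>i<horizon. (\<Sum>e\<in>T. dev (e, i) a) + (\<Sum>e\<in>T. of_bool (i \<le> a e) / real (k - i)) - c)
      \<le> (\<Sum>i<horizon. real (?Y i))"
    unfolding c_def by (intro sum_mono card_avoiding_ge) simp
  moreover have "(\<Sum>i<horizon. \<Sum>e\<in>T. dev (e, i) a) = ?S"
    by (subst sum.swap) (simp add: sum.cartesian_product)
  moreover have "(\<Sum>i<horizon. \<Sum>e\<in>T. of_bool (i \<le> a e) / real (k - i)) = ?Z + card T * (?t / k)"
    by (subst sum.swap) (simp add: hazard_def hazard_dev_def sum_subtractf)
  ultimately have main: "?S + (?Z + card T * (?t / k)) - ?t * c \<le> ?g"
    using g by (simp add: sum.distrib sum_subtractf)
  define x where "x = \<bar>?S\<bar> + \<bar>?Z\<bar>"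
  have x: "x \<ge> 0" "- x \<le> ?S + ?Z" unfolding x_def by linarith+
  have tk: "0 < ?t / k" "1 \<le> 3 * (?t / k)"
    using horizon k by (simp_all add: field_simps)
  have "?t * c = ?t / k * (3 / 2 * (real d)\<^sup>2 * ?g)" by (simp add: c_def)
  then have "card T * (?t / k) \<le> ?g + x + ?t / k * (3 / 2 * (real d)\<^sup>2 * ?g)"
    using main x by linarith
  \<comment> \<open>The factor \<open>3 * (horizon / k) \<ge> 1\<close> is inserted so that
    \<open>horizon / k\<close> can be cancelled from all terms.\<close>
  also have "\<dots> \<le> (?g + x) * (3 * (?t / k)) + ?t / k * (3 / 2 * (real d)\<^sup>2 * ?g)"
    using mult_left_mono[OF tk(2), of "?g + x"] x by simp
  also have "\<dots> = (3 * ?g + 3 * x + 3 / 2 * (real d)\<^sup>2 * ?g) * (?t / k)"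
    by (simp add: algebra_simps add_divide_distrib)
  finally have "card T \<le> 3 * ?g + 3 * x + 3 / 2 * (real d)\<^sup>2 * ?g"
    using tk(1) by (simp only: mult_le_cancel_right_pos)
  then show ?thesis unfolding x_def by (simp add: algebra_simps)
qed

text \<open>There are \<open>card T * horizon\<close> pairs with second moment at most
  \<open>2 / k\<close>; since \<open>horizon \<le> k\<close>, the number of machines drops
  out.\<close>

lemma prob_dev_ge:
  assumes "y > 0"
  shows "measure_pmf.prob (assignment k E) {a. y \<le> \<bar>\<Sum>p\<in>T \<times> {..<horizon}. dev p a\<bar>} \<le>
    2 * card T / y\<^sup>2"
proof -
  have "measure_pmf.prob (assignment k E) {a. y \<le> \<bar>\<Sum>p\<in>T \<times> {..<horizon}. dev p a\<bar>} \<le>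
      card (T \<times> {..<horizon}) * (2 / k) / y\<^sup>2"
  proof (rule prob_orthogonal_sum_ge)
    fix p q assume "p \<in> T \<times> {..<horizon}" "q \<in> T \<times> {..<horizon}" "p \<noteq> q"
    then show "measure_pmf.expectation (assignment k E) (\<lambda>a. dev p a * dev q a) = 0"
      using dev_orthogonal[of "fst p" "fst q" "snd p" "snd q"] T_subset horizon(2)
      by (cases p; cases q) (simp add: subset_iff)
  next
    fix p assume "p \<in> T \<times> {..<horizon}"
    then show "measure_pmf.expectation (assignment k E) (\<lambda>a. (dev p a)\<^sup>2) \<le> 2 / k"
      using dev_second_moment[of "fst p" "snd p"] T_subset horizon(2)
      by (cases p) (simp add: subset_iff)
  qed (use assms finE finT k in auto)
  also have "card (T \<times> {..<horizon}) * (2 / k) = card T * (2 * (horizon / k))"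
    by (simp add: card_cartesian_product)
  also have "card T * (2 * (horizon / k)) / y\<^sup>2 \<le> 2 * card T / y\<^sup>2"
  proof (rule divide_right_mono)
    have "real horizon / k \<le> 1" using horizon k by simp
    then have "card T * (2 * (horizon / k)) \<le> real (card T) * (2 * 1)"
      by (intro mult_left_mono) auto
    then show "card T * (2 * (horizon / k)) \<le> 2 * card T" by simp
  qed simp
  finally show ?thesis .
qed

lemma prob_hazard_dev_ge:
  assumes "y > 0"
  shows "measure_pmf.prob (assignment k E) {a. y \<le> \<bar>\<Sum>e\<in>T. hazard_dev e a\<bar>} \<le>
    card T * (9 / 4) / y\<^sup>2"
  using hazard_dev_orthogonal hazard_dev_second_moment T_subset assms finE finT k
  by (intro prob_orthogonal_sum_ge) auto

end

lemma greedy_step_meets: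
  assumes "e \<in> N" "e \<noteq> {}" obtains f where "f \<in> greedy_step M N" "\<not> disjnt e f"
proof (cases "\<forall>f\<in>M. disjnt e f")
  case True
  then have "e \<in> greedy_step M N" using assms by (auto simp: greedy_step_def)
  then show ?thesis using that assms(2) by (auto simp: disjnt_def)
next
  case False
  then show ?thesis using that by (auto simp: greedy_step_def)
qed

section \<open>Failure probability of the approximation\<close>

context greedy_run begin

text \<open>The comparison \<open>3 / 2 * d\<^sup>2 \<le> 3 * d * (d - 1)\<close> fails for
  \<open>d = 1\<close>, but there every set of edges is a matching and each machine keeps its whole
  part. The output meets every edge, and singletons that meet are equal.\<close>

lemma cur_eq_of_singletons:
  assumes "d = 1" "\<And>e. e \<in> E \<Longrightarrow> a e < k"
  shows "cur a k = E"
proof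
  show "cur a k \<subseteq> E" using cur_matching by (auto simp: is_matching_def)
  have single: "\<exists>x. e = {x}" if "e \<in> E" for e
    using that E assms(1) by (auto simp: uniform_hypergraph_def card_1_singleton_iff)
  have matching: "is_matching F F" if "F \<subseteq> E" for F
    using that single by (fastforce simp: is_matching_def pairwise_def disjnt_def)
  have MM_eq: "MM i F = F" if "F \<subseteq> E" for i F
  proof (rule card_subset_eq)
    show "finite F" using that finE finite_subset by blast
    then show "card (MM i F) = card F"
      using MM_maximum[OF that] card_le_matching_number[OF _ matching[OF that]]
        matching_number_le_card[of F] by (auto simp: is_maximum_matching_def)
  qed (rule MM_subset[OF that])
  show "E \<subseteq> cur a k"
  proof
    fix e assume e: "e \<in> E"
    define i where "i = a e"
    have "e \<in> MM i (part a i)" using e by (simp add: MM_eq part_subset part_def i_def)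
    moreover have "e \<noteq> {}" using single[OF e] by auto
    ultimately obtain f where f: "f \<in> cur a (Suc i)" "\<not> disjnt e f"
      unfolding cur_def by (auto elim: greedy_step_meets)
    then have "f \<in> cur a k"
      using greedy_mono[of "Suc i" k] assms(2)[OF e] by (auto simp: cur_def i_def)
    moreover have "e = f"
      using single[OF e] single[of f] f(2) calculation cur_matching
      by (fastforce simp: is_matching_def disjnt_def)
    ultimately show "e \<in> cur a k" by simp
  qed
qed

text \<open>By \<open>card_T_le\<close>, a failed approximation forces one of the two deviation sums
  to reach \<open>y\<close>, which is of order \<open>\<epsilon> * card T\<close>, whereas their
  second moments are of order \<open>card T\<close>.\<close>

lemma prob_not_approximates_le:
  assumes d2: "d \<ge> 2" and \<epsilon>: "0 < \<epsilon>" "\<epsilon> \<le> 1"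
    and T_max: "card T = matching_number E" "card T > 0"
  shows "measure_pmf.prob (assignment k E)
      {a. \<not> approximates (3 * real d * (real d - 1) + 3 + \<epsilon>) E (cur a k)} \<le>
    153 * (3 * real d * (real d - 1) + 4)\<^sup>2 / (\<epsilon>\<^sup>2 * card T)"
proof -
  define K where "K = 3 * real d * (real d - 1) + 3"
  \<comment> \<open>Two deviations below \<open>y\<close> contribute less than
    \<open>6 * y = \<epsilon> * card T / (K + 1)\<close> to \<open>card_T_le\<close>, just what the
    slack \<open>\<epsilon>\<close> in the ratio absorbs.\<close>
  define y where "y = \<epsilon> * card T / (6 * (K + 1))"
  let ?S = "\<lambda>a. \<bar>\<Sum>p\<in>T \<times> {..<horizon}. dev p a\<bar>" and ?Z = "\<lambda>a. \<bar>\<Sum>e\<in>T. hazard_dev e a\<bar>"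
  let ?P = "measure_pmf.prob (assignment k E)"
  have K: "K \<ge> 3" using d2 by (simp add: K_def)
  have y: "y > 0" using \<epsilon> T_max K by (simp add: y_def)
  have "0 \<le> (real d - 2) * real d" using d2 by simp
  then have K2: "3 + 3 / 2 * (real d)\<^sup>2 \<le> K"
    by (simp add: K_def power2_eq_square algebra_simps)
  have sub: "y \<le> ?S a \<or> y \<le> ?Z a" if "\<not> approximates (K + \<epsilon>) E (cur a k)" for a
  proof (rule ccontr)
    assume "\<not> (y \<le> ?S a \<or> y \<le> ?Z a)"
    then have x: "?S a + ?Z a < 2 * y" by linarith
    let ?g = "real (card (cur a k))"
    have g: "(K + \<epsilon>) * ?g < card T"
      using that cur_matching[of a k] T_max by (simp add: approximates_def)
    have "(3 + 3 / 2 * (real d)\<^sup>2) * ?g \<le> K * ?g"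
      using K2 by (intro mult_right_mono) auto
    then have "real (card T) \<le> K * ?g + 3 * (?S a + ?Z a)"
      by (intro order_trans[OF card_T_le[of a]] add_right_mono)
    also have "\<dots> < K * ?g + 6 * y"
      using x by simp
    also have "6 * y = \<epsilon> * card T / (K + 1)" using K by (simp add: y_def field_simps)
    \<comment> \<open>The multiplication by \<open>K + \<epsilon>\<close> brings in the failed
      approximation \<open>(K + \<epsilon>) * ?g < card T\<close>; then
      \<open>\<epsilon> \<le> 1\<close> bounds \<open>(K + \<epsilon>) / (K + 1)\<close> by
      1.\<close>
    finally have "(K + \<epsilon>) * card T < (K + \<epsilon>) * (K * ?g + \<epsilon> * card T / (K + 1))"
      using K \<epsilon> by (intro mult_strict_left_mono) auto
    also have "\<dots> = K * ((K + \<epsilon>) * ?g) + (K + \<epsilon>) / (K + 1) * (\<epsilon> * card T)"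
      by (simp add: algebra_simps)
    also have "\<dots> \<le> K * card T + 1 * (\<epsilon> * card T)"
      using g K \<epsilon> by (intro add_mono mult_left_mono mult_right_mono) auto
    finally show False by (simp add: algebra_simps)
  qed
  have "?P {a. \<not> approximates (K + \<epsilon>) E (cur a k)} \<le> ?P ({a. y \<le> ?S a} \<union> {a. y \<le> ?Z a})"
    using sub by (intro measure_pmf.finite_measure_mono) auto
  also have "\<dots> \<le> ?P {a. y \<le> ?S a} + ?P {a. y \<le> ?Z a}"
    by (rule measure_Un_le) auto
  also have "\<dots> \<le> 2 * card T / y\<^sup>2 + card T * (9 / 4) / y\<^sup>2"
    by (intro add_mono prob_dev_ge prob_hazard_dev_ge y)
  \<comment> \<open>The constant is \<open>36 * (2 + 9 / 4)\<close>, where 36 comes from the square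
    of the 6 in \<open>y\<close>.\<close>
  also have "\<dots> = 153 * (K + 1)\<^sup>2 / (\<epsilon>\<^sup>2 * card T)"
    using T_max \<epsilon> K by (simp add: y_def field_simps power2_eq_square)
  finally show ?thesis by (simp add: K_def add.assoc)
qed

end

lemma greedy_output_eq:
  "greedy_output k MM E =
    map_pmf (\<lambda>a. greedy (\<lambda>j. MM j {e\<in>E. a e = j}) k) (assignment k E)"
  by (simp add: greedy_output_def random_partition_def assignment_def pmf.map_comp o_def)

lemma prob_greedy_approximates_ge:
  assumes d: "d \<ge> 1" and k: "k > 0" and E: "uniform_hypergraph d V E"
    and MM: "maximum_matching_rule d V MM" and \<epsilon>: "0 < \<epsilon>" "\<epsilon> \<le> 1"
  shows "measure_pmf.prob (greedy_output k MM E)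
      {M. approximates (3 * real d * (real d - 1) + 3 + \<epsilon>) E M} \<ge>
    1 - 153 * (3 * real d * (real d - 1) + 4)\<^sup>2 / (\<epsilon>\<^sup>2 * matching_number E)"
proof -
  let ?\<rho> = "3 * real d * (real d - 1) + 3 + \<epsilon>"
  have fin: "finite E" using E by (rule uniform_hypergraph_finite)
  obtain T where Tm: "is_maximum_matching E T" using maximum_matching_exists[OF fin] .
  interpret greedy_run d k V E T MM
    using assms Tm by unfold_locales (auto simp: is_maximum_matching_def)
  have eq: "greedy_output k MM E = map_pmf (\<lambda>a. cur a k) (assignment k E)"
    by (simp add: greedy_output_eq cur_def part_def)
  have prob: "measure_pmf.prob (greedy_output k MM E) {M. approximates ?\<rho> E M} =
      1 - measure_pmf.prob (assignment k E) {a. \<not> approximates ?\<rho> E (cur a k)}"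
    unfolding eq measure_map_pmf
    by (subst measure_pmf.prob_compl[symmetric]) (auto intro!: arg_cong2[of _ _ _ _ measure])
  have \<rho>: "?\<rho> \<ge> 1" using d \<epsilon> by simp
  \<comment> \<open>In the first case the error term is a division by 0, hence 0, and success must
    be certain; it is, since any matching qualifies.\<close>
  consider "matching_number E = 0" | "d = 1" | "d \<ge> 2" "matching_number E > 0"
    using d by linarith
  then show ?thesis
  proof cases
    case 1
    then have "approximates ?\<rho> E (cur a k)" for a
      using cur_matching \<rho> by (simp add: approximates_def)
    then show ?thesis using prob 1 by simp
  next
    case 2
    have "approximates ?\<rho> E (cur a k)" if "a \<in> set_pmf (assignment k E)" for a
    proof -
      have "cur a k = E"
        using that k fin by (intro cur_eq_of_singletons 2) (auto simp: set_assignment PiE_dflt_def)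
      then have "matching_number E \<le> card (cur a k)" using matching_number_le_card[OF fin] by simp
      also have "real (card (cur a k)) \<le> ?\<rho> * card (cur a k)"
        using \<rho> mult_right_mono[of 1 ?\<rho> "real (card (cur a k))"] by simp
      finally show ?thesis using cur_matching by (simp add: approximates_def)
    qed
    then have "measure_pmf.prob (assignment k E) {a. \<not> approximates ?\<rho> E (cur a k)} = 0"
      by (auto simp: measure_pmf_zero_iff)
    then show ?thesis using prob by simp
  next
    case 3
    have Tc: "card T = matching_number E" using Tm by (simp add: is_maximum_matching_def)
    then have "card T > 0" using 3 by simp
    then show ?thesis
      using prob prob_not_approximates_le[OF 3(1) \<epsilon> Tc \<open>card T > 0\<close>] unfolding Tc by simp
  qed
qed

section \<open>MPC simulation\<close>

text \<open>Code words of one fixed nonzero length can be cut off from the front one by one.\<close>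

lemma concat_map_inj:
  assumes "inj_on g A" "\<And>x. x \<in> A \<Longrightarrow> length (g x) = l" "\<And>x. x \<in> A \<Longrightarrow> g x \<noteq> []"
  assumes "set xs \<subseteq> A" "set ys \<subseteq> A" "concat (map g xs) = concat (map g ys)"
  shows "xs = ys"
  using assms(4-6)
proof (induction xs arbitrary: ys)
  case Nil
  then show ?case using assms(3) by (cases ys) auto
next
  case (Cons x xs)
  then obtain y ys' where ys: "ys = y # ys'" using assms(3) by (cases ys) auto
  then have "length (g x) = length (g y)" using assms(2) Cons.prems by simp
  then have "g x = g y" "concat (map g xs) = concat (map g ys')"
    using Cons.prems ys by simp_all
  moreover have "x \<in> A" "y \<in> A" using Cons.prems ys by auto
  ultimately have "x = y" using assms(1) by (simp add: inj_on_eq_iff)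
  moreover have "xs = ys'"
    by (rule Cons.IH) (use Cons.prems ys \<open>concat (map g xs) = concat (map g ys')\<close> in auto)
  ultimately show ?case using ys by simp
qed

lemma distinct_concat_upt_iff:
  "distinct (concat (map L [0..<k])) \<longleftrightarrow>
    (\<forall>i<k. distinct (L i)) \<and> (\<forall>i<k. \<forall>j<k. i \<noteq> j \<longrightarrow> set (L i) \<inter> set (L j) = {})"
proof (induction k)
  case (Suc k)
  have "distinct (concat (map L [0..<Suc k])) \<longleftrightarrow> distinct (concat (map L [0..<k])) \<and>
      distinct (L k) \<and> (\<forall>i<k. set (L i) \<inter> set (L k) = {})"
    by (simp add: Int_UN_distrib2 atLeast0LessThan) blast
  also have "\<dots> \<longleftrightarrow> (\<forall>i<Suc k. distinct (L i)) \<and>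
      (\<forall>i<Suc k. \<forall>j<Suc k. i \<noteq> j \<longrightarrow> set (L i) \<inter> set (L j) = {})"
    (is "?l \<longleftrightarrow> ?r")
  proof
    assume ?l
    then show ?r unfolding Suc.IH less_Suc_eq by (metis Int_commute)
  next
    assume ?r
    then show ?l unfolding Suc.IH less_Suc_eq by (metis less_irrefl)
  qed
  finally show ?case .
qed simp

lemma distributesD:
  assumes "distributes k E L"
  shows "i < k \<Longrightarrow> j < k \<Longrightarrow> i \<noteq> j \<Longrightarrow> set (L i) \<inter> set (L j) = {}"
    "(\<Union>i<k. set (L i)) = E" "i < k \<Longrightarrow> set (L i) \<subseteq> E"
  using assms unfolding distributes_def distinct_concat_upt_iff by (auto simp: atLeast0LessThan)

text \<open>With \<open>P\<close> selecting the edges assigned to one machine, this is the number of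
  edges it receives in the first round.\<close>

lemma sum_length_filter_concat:
  assumes "distributes k E L"
  shows "(\<Sum>j<k. length (filter P (L j))) = card {e\<in>E. P e}"
proof -
  have "(\<Sum>j<k. length (filter P (L j))) = length (filter P (concat (map L [0..<k])))"
    by (simp add: filter_concat length_concat o_def interv_sum_list_conv_sum_set_nat atLeast0LessThan)
  also have "\<dots> = card (set (filter P (concat (map L [0..<k]))))"
    using assms by (intro distinct_card[symmetric] distinct_filter) (simp add: distributes_def)
  also have "set (filter P (concat (map L [0..<k]))) = {e\<in>E. P e}"
    using assms unfolding distributes_def by (metis set_filter)
  finally show ?thesis .
qed

text \<open>Each edge has at most one recipient, so a machine sends no more edges than it
  holds.\<close>

lemma sum_length_filter_eq_le:
  fixes a :: "'e \<Rightarrow> nat" shows "(\<Sum>j<k. length (filter (\<lambda>e. a e = j) l)) \<le> length l"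
proof (induction l)
  case (Cons e l)
  have "(\<Sum>j<k. length (filter (\<lambda>e. a e = j) (e # l))) =
      (\<Sum>j<k. of_bool (a e = j) + length (filter (\<lambda>e. a e = j) l))"
    by (intro sum.cong) auto
  also have "\<dots> = (\<Sum>j<k. of_bool (a e = j)) + (\<Sum>j<k. length (filter (\<lambda>e. a e = j) l))"
    by (rule sum.distrib)
  also have "(\<Sum>j<k. of_bool (a e = j) :: nat) \<le> 1" by (simp add: of_bool_def)
  finally show ?case using Cons by simp
qed simp

text \<open>Independent assignments of disjoint sets form a single assignment of their union. Thus
  machines that draw only for their own edges realize the global random partition. The last premise
  says that \<open>g i\<close> reads only the values on \<open>S i\<close>.\<close>

lemma Pi_pmf_map_assignment:
  assumes "finite K" "\<And>i. i \<in> K \<Longrightarrow> finite (S i)"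
    and "\<And>i j. i \<in> K \<Longrightarrow> j \<in> K \<Longrightarrow> i \<noteq> j \<Longrightarrow> S i \<inter> S j = {}"
    and "\<And>i a b. i \<in> K \<Longrightarrow> (\<And>e. e \<in> S i \<Longrightarrow> a e = b e) \<Longrightarrow> g i a = g i b"
  shows "Pi_pmf K c (\<lambda>i. map_pmf (g i) (assignment k (S i))) =
    map_pmf (\<lambda>a i. if i \<in> K then g i a else c) (assignment k (\<Union>i\<in>K. S i))"
  using assms
proof (induction K rule: finite_induct)
  case empty
  show ?case by (simp add: assignment_def)
next
  case (insert x K)
  let ?U = "\<Union>i\<in>K. S i"
  have IH: "Pi_pmf K c (\<lambda>i. map_pmf (g i) (assignment k (S i))) =
      map_pmf (\<lambda>a i. if i \<in> K then g i a else c) (assignment k ?U)"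
  proof (rule insert.IH)
    show "finite (S i)" if "i \<in> K" for i using that insert.prems(1) by simp
    show "S i \<inter> S j = {}" if "i \<in> K" "j \<in> K" "i \<noteq> j" for i j
      using that by (intro insert.prems(2)) auto
    show "g i a = g i b" if "i \<in> K" "\<And>e. e \<in> S i \<Longrightarrow> a e = b e" for i a b
      using that(1) by (intro insert.prems(3) that(2)) simp_all
  qed
  have "S x \<inter> S i = {}" if "i \<in> K" for i
    using insert.hyps that by (intro insert.prems(2)) auto
  then have disj: "S x \<inter> ?U = {}" by blast
  have fin: "finite (S x)" "finite ?U" using insert.prems(1) insert.hyps by simp_all
  have "assignment k (S x \<union> ?U) = map_pmf (\<lambda>(f, h) e. if e \<in> S x then f e else h e)
      (pair_pmf (assignment k (S x)) (assignment k ?U))"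
    unfolding assignment_def using disj fin by (intro Pi_pmf_union) auto
  then have R: "map_pmf (\<lambda>a i. if i \<in> insert x K then g i a else c)
        (assignment k (\<Union>i\<in>insert x K. S i)) =
      map_pmf (\<lambda>(f, h) i. if i \<in> insert x K then g i (\<lambda>e. if e \<in> S x then f e else h e) else c)
        (pair_pmf (assignment k (S x)) (assignment k ?U))"
    by (simp add: pmf.map_comp o_def case_prod_beta')
  have "Pi_pmf (insert x K) c (\<lambda>i. map_pmf (g i) (assignment k (S i))) =
      map_pmf (\<lambda>(f, h). (\<lambda>i. if i \<in> K then g i h else c)(x := g x f))
        (pair_pmf (assignment k (S x)) (assignment k ?U))"
    unfolding Pi_pmf_insert[OF insert.hyps] IH map_pair[symmetric]
    by (simp add: pmf.map_comp o_def case_prod_beta')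
  also have "\<dots> = map_pmf
      (\<lambda>(f, h) i. if i \<in> insert x K then g i (\<lambda>e. if e \<in> S x then f e else h e) else c)
        (pair_pmf (assignment k (S x)) (assignment k ?U))"
  proof (rule map_pmf_cong[OF refl], clarify, rule ext)
    fix f h i
    have "g x f = g x (\<lambda>e. if e \<in> S x then f e else h e)"
      by (rule insert.prems(3)) auto
    moreover have "g i h = g i (\<lambda>e. if e \<in> S x then f e else h e)" if "i \<in> K"
      using that disj by (intro insert.prems(3)) auto
    ultimately show "((\<lambda>i. if i \<in> K then g i h else c)(x := g x f)) i =
        (if i \<in> insert x K then g i (\<lambda>e. if e \<in> S x then f e else h e) else c)"
      using insert.hyps by auto
  qed
  finally show ?case unfolding R .
qed

section \<open>Encoding of edges as bit strings, and the algorithm for the machines\<close>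

lemma less_two_power_id_width: "n < 2 ^ id_width n"
proof -
  have "log 2 (real n + 1) \<le> real (id_width n)"
    by (simp add: id_width_def)
  then have "real n + 1 \<le> 2 powr real (id_width n)"
    by (subst (asm) log_le_iff) auto
  then have "real n + 1 \<le> real (2 ^ id_width n)" by (simp add: powr_realpow)
  then show ?thesis by linarith
qed

lemma map_bit_inj:
  assumes "x < n" "y < n" "map (bit x) [0..<id_width n] = map (bit y) [0..<id_width n]"
  shows "x = (y::nat)"
proof -
  have "take_bit (id_width n) x = take_bit (id_width n) y"
    using assms(3) by (intro bit_eqI) (auto simp: bit_take_bit_iff)
  moreover have "x < 2 ^ id_width n" "y < 2 ^ id_width n"
    using assms(1,2) less_two_power_id_width[of n] by simp_all
  ultimately show ?thesis by (simp add: take_bit_nat_eq_self)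
qed

locale mpc_greedy =
  fixes d n k :: nat and V :: "'a set" and lab :: "'a \<Rightarrow> nat"
    and MM :: "nat \<Rightarrow> 'a set set \<Rightarrow> 'a set set"
  assumes d: "d \<ge> 1" and k: "k > 0" and V: "finite V" "card V = n"
    and lab: "bij_betw lab V {..<n}" and MM: "maximum_matching_rule d V MM"
begin

text \<open>All sets that may occur as edges. Encoding and decoding refer to these, so that the
  algorithm does not depend on the input \<open>E\<close>.\<close>

definition edges :: "'a set set" where "edges = {e. e \<subseteq> V \<and> card e = d}"

definition block :: nat where "block = d * id_width n"

lemma uniform_iff: "uniform_hypergraph d V F \<longleftrightarrow> F \<subseteq> edges"
  using V by (auto simp: uniform_hypergraph_def edges_def)

lemma finite_edges: "finite edges"
  using V by (auto simp: edges_def)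

lemma lab_inj: "inj_on lab V" using lab by (rule bij_betw_imp_inj_on)

lemma lab_image:
  assumes "e \<in> edges" shows "lab ` e \<subseteq> {..<n}" "finite (lab ` e)" "card (lab ` e) = d"
proof -
  have e: "e \<subseteq> V" "card e = d" using assms by (auto simp: edges_def)
  show "lab ` e \<subseteq> {..<n}" using lab e by (auto simp: bij_betw_def)
  then show "finite (lab ` e)" by (rule finite_subset) simp
  show "card (lab ` e) = d" using e lab_inj by (metis card_image inj_on_subset)
qed

lemma length_edge_bits: "e \<in> edges \<Longrightarrow> length (edge_bits n lab e) = block"
  using lab_image by (simp add: edge_bits_def length_concat o_def sum_list_triv block_def)

lemma block_pos: "e \<in> edges \<Longrightarrow> block > 0"
proof -
  assume e: "e \<in> edges"
  have "d \<le> n" using card_mono[OF _ lab_image(1)[OF e]] lab_image(3)[OF e] by simp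
  then have "n \<noteq> 0" using d by simp
  then have "id_width n \<noteq> 0" using less_two_power_id_width[of n] by (intro notI) simp
  then show "block > 0" using d by (simp add: block_def)
qed

text \<open>Identifiers have \<open>id_width n\<close> bits each, so \<open>concat_map_inj\<close>
  recovers the sorted list of labels, and \<open>lab\<close> is injective on
  \<open>V\<close>.\<close>

lemma inj_on_edge_bits: "inj_on (edge_bits n lab) edges"
proof (rule inj_onI)
  fix e f assume e: "e \<in> edges" and f: "f \<in> edges" and eq: "edge_bits n lab e = edge_bits n lab f"
  have pos: "id_width n > 0" using block_pos[OF e] by (simp add: block_def)
  have "inj_on (\<lambda>x. map (bit x) [0..<id_width n]) {..<n}"
    by (rule inj_onI) (auto dest: map_bit_inj simp del: map_eq_conv)
  then have "sorted_list_of_set (lab ` e) = sorted_list_of_set (lab ` f)"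
    using lab_image[OF e] lab_image[OF f] eq pos unfolding edge_bits_def
    by (elim concat_map_inj[where l = "id_width n"]) auto
  then have "lab ` e = lab ` f"
    using lab_image[OF e] lab_image[OF f] by (metis set_sorted_list_of_set)
  then show "e = f"
    using e f lab_inj by (auto simp: edges_def inj_on_image_eq_iff)
qed

lemma length_edges_bits: "set es \<subseteq> edges \<Longrightarrow> length (edges_bits n lab es) = length es * block"
  by (induction es) (auto simp: edges_bits_def length_edge_bits)

text \<open>A description without a decoding procedure is enough, as local computation is
  arbitrary.\<close>

definition decode :: "bool list \<Rightarrow> 'a set list" where
  "decode b = (THE es. set es \<subseteq> edges \<and> edges_bits n lab es = b)"

lemma decode_edges_bits [simp]:
  assumes "set es \<subseteq> edges" shows "decode (edges_bits n lab es) = es"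
  unfolding decode_def
proof (rule the_equality)
  fix es' assume es': "set es' \<subseteq> edges \<and> edges_bits n lab es' = edges_bits n lab es"
  have "edge_bits n lab e \<noteq> []" if "e \<in> edges" for e
    using block_pos[OF that] length_edge_bits[OF that] by auto
  then show "es' = es"
    using es' assms unfolding edges_bits_def
    by (intro concat_map_inj[OF inj_on_edge_bits length_edge_bits]) auto
qed (use assms in auto)

definition listing :: "'a set set \<Rightarrow> 'a set list" where
  "listing F = (SOME es. distinct es \<and> set es = F)"

definition encode :: "'a set set \<Rightarrow> bool list" where
  "encode F = edges_bits n lab (listing F)"

lemma listing:
  assumes "F \<subseteq> edges" shows "distinct (listing F)" "set (listing F) = F"
proof -
  have "\<exists>es. distinct es \<and> set es = F"
    using finite_distinct_list[of F] finite_subset[OF assms finite_edges] by blast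
  then have "distinct (listing F) \<and> set (listing F) = F"
    unfolding listing_def by (rule someI_ex)
  then show "distinct (listing F)" "set (listing F) = F" by auto
qed

lemma set_decode_encode [simp]: "F \<subseteq> edges \<Longrightarrow> set (decode (encode F)) = F"
  by (simp add: encode_def listing)

lemma length_encode: "F \<subseteq> edges \<Longrightarrow> length (encode F) = card F * block"
  using listing[of F] distinct_card[of "listing F"] by (simp add: encode_def length_edges_bits)

text \<open>Only \<open>V\<close>, \<open>lab\<close>, \<open>d\<close>, \<open>k\<close> and
  \<open>MM\<close> enter, so one algorithm serves all inputs. In the last round, machine 0
  recognizes the matching of part \<open>j\<close> by its sender \<open>j\<close>, which preserves
  the greedy order, and it keeps the result by sending it to itself.\<close>

definition alg :: mpc_algorithm where
  "alg r i mem =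
    (if r = 0 then
       map_pmf (\<lambda>a j. edges_bits n lab (filter (\<lambda>e. a e = j) (decode (mem i))))
         (assignment k (set (decode (mem i))))
     else if r = 1 then
       return_pmf (\<lambda>j. if j = 0 then encode (MM i (\<Union>j<k. set (decode (mem j)))) else [])
     else
       return_pmf (\<lambda>j. if i = 0 \<and> j = 0 then encode (greedy (\<lambda>j. set (decode (mem j))) k) else []))"

end

section \<open>The run on a fixed input\<close>

locale mpc_greedy_input = mpc_greedy +
  fixes E :: "'a set set" and L :: "nat \<Rightarrow> 'a set list"
  assumes E: "uniform_hypergraph d V E" and L: "distributes k E L"
begin

definition part :: "('a set \<Rightarrow> nat) \<Rightarrow> nat \<Rightarrow> 'a set set" where
  "part a i = {e\<in>E. a e = i}"

definition result :: "('a set \<Rightarrow> nat) \<Rightarrow> 'a set set" where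
  "result a = greedy (\<lambda>j. MM j (part a j)) k"

text \<open>This and the next two definitions are the states after the three rounds as functions of
  the assignment. Senders outside \<open>{..<k}\<close> have empty messages, matching the default
  value in \<open>mpc_round\<close>.\<close>

definition state1 :: "('a set \<Rightarrow> nat) \<Rightarrow> mpc_state" where
  "state1 a = (\<lambda>j i. if i < k then edges_bits n lab (filter (\<lambda>e. a e = j) (L i)) else [])"

definition state2 :: "('a set \<Rightarrow> nat) \<Rightarrow> mpc_state" where
  "state2 a = (\<lambda>j i. if i < k \<and> j = 0 then encode (MM i (part a i)) else [])"

definition state3 :: "('a set \<Rightarrow> nat) \<Rightarrow> mpc_state" where
  "state3 a = (\<lambda>j i. if i = 0 \<and> j = 0 then encode (result a) else [])"

lemma E_edges: "E \<subseteq> edges" using E by (simp add: uniform_iff)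

lemma L_edges: "i < k \<Longrightarrow> set (L i) \<subseteq> edges"
  using distributesD(3)[OF L] E_edges by blast

lemma MM_part: "MM i (part a i) \<subseteq> part a i" "pairwise disjnt (MM i (part a i))"
proof -
  have "uniform_hypergraph d V (part a i)" using E_edges by (auto simp: uniform_iff part_def)
  then have "is_matching (part a i) (MM i (part a i))"
    using MM by (auto simp: maximum_matching_rule_def is_maximum_matching_def)
  then show "MM i (part a i) \<subseteq> part a i" "pairwise disjnt (MM i (part a i))"
    by (auto simp: is_matching_def)
qed

lemma MM_part_edges: "MM i (part a i) \<subseteq> edges"
  using MM_part(1)[of i a] E_edges by (auto simp: part_def)

lemma result_subset: "result a \<subseteq> (\<Union>i<k. MM i (part a i))"
  unfolding result_def by (rule greedy_subset)

lemma result_edges: "result a \<subseteq> edges"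
  using result_subset MM_part_edges by (rule order_trans[OF _ UN_least])

text \<open>The input lists are disjoint and cover \<open>E\<close>, so the local draws merge into
  one assignment by \<open>Pi_pmf_map_assignment\<close>.\<close>

lemma round1: "mpc_round k (alg 0) (input_state n lab L) = map_pmf state1 (assignment k E)"
proof -
  let ?g = "\<lambda>i a j. edges_bits n lab (filter (\<lambda>e. a e = j) (L i))"
  have "Pi_pmf {..<k} (\<lambda>_. []) (\<lambda>i. alg 0 i (input_state n lab L i)) =
      Pi_pmf {..<k} (\<lambda>_. []) (\<lambda>i. map_pmf (?g i) (assignment k (set (L i))))"
    by (rule Pi_pmf_cong) (simp_all add: alg_def input_state_def L_edges)
  also have "\<dots> = map_pmf (\<lambda>a i. if i \<in> {..<k} then ?g i a else (\<lambda>_. []))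
      (assignment k (\<Union>i\<in>{..<k}. set (L i)))"
  proof (rule Pi_pmf_map_assignment)
    fix i :: nat and a b :: "'a set \<Rightarrow> nat"
    assume "\<And>e. e \<in> set (L i) \<Longrightarrow> a e = b e"
    then show "?g i a = ?g i b" by (auto intro!: ext arg_cong[of _ _ "edges_bits n lab"] filter_cong)
  qed (use distributesD(1)[OF L] in auto)
  finally show ?thesis
    by (simp add: mpc_round_def distributesD(2)[OF L] pmf.map_comp o_def)
       (auto intro!: map_pmf_cong ext simp: state1_def)
qed

lemma round2: "mpc_round k (alg 1) (state1 a) = return_pmf (state2 a)"
proof -
  have dec: "(\<Union>j<k. set (decode (state1 a i j))) = part a i" for i
  proof -
    have "set (decode (state1 a i j)) = {e\<in>set (L j). a e = i}" if "j < k" for j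
      using that L_edges[OF that] by (subst state1_def, simp, subst decode_edges_bits) auto
    then have "(\<Union>j<k. set (decode (state1 a i j))) = (\<Union>j<k. {e\<in>set (L j). a e = i})" by auto
    then show ?thesis using distributesD(2)[OF L] by (auto simp: part_def)
  qed
  have "alg 1 i (state1 a i) = return_pmf (\<lambda>j. if j = 0 then encode (MM i (part a i)) else [])"
    for i unfolding alg_def dec by simp
  then show ?thesis
    by (simp add: mpc_round_def) (auto intro!: ext simp: state2_def)
qed

lemma round3: "mpc_round k (alg 2) (state2 a) = return_pmf (state3 a)"
proof -
  have dec: "greedy (\<lambda>j. set (decode (state2 a 0 j))) k = result a"
    unfolding result_def by (rule greedy_cong) (simp add: state2_def MM_part_edges)
  have "Pi_pmf {..<k} (\<lambda>_. []) (\<lambda>i. alg 2 i (state2 a i)) =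
      Pi_pmf {..<k} (\<lambda>_. []) (\<lambda>i. return_pmf (\<lambda>j. if i = 0 \<and> j = 0 then encode (result a) else []))"
    by (rule Pi_pmf_cong) (auto simp: alg_def dec intro!: arg_cong[of _ _ return_pmf] ext)
  then show ?thesis
    using k by (simp add: mpc_round_def) (auto intro!: ext simp: state3_def)
qed

text \<open>Only the first round is random, so the whole run is a function of the assignment drawn
  there.\<close>

lemma run: "mpc_run k alg 3 (input_state n lab L) =
  map_pmf (\<lambda>a. [state3 a, state2 a, state1 a, input_state n lab L]) (assignment k E)"
proof -
  let ?X = "input_state n lab L" and ?p = "assignment k E"
  have 1: "mpc_run k alg 1 ?X = map_pmf (\<lambda>a. [state1 a, ?X]) ?p"
    by (simp add: bind_return_pmf round1 pmf.map_comp o_def)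
  have "mpc_run k alg (Suc 1) ?X = map_pmf (\<lambda>a. [state2 a, state1 a, ?X]) ?p"
    unfolding mpc_run.simps(2) 1 bind_map_pmf by (simp only: round2 list.sel map_return_pmf map_pmf_def bind_return_pmf)
  then have 2: "mpc_run k alg 2 ?X = map_pmf (\<lambda>a. [state2 a, state1 a, ?X]) ?p"
    by (simp only: Suc_1)
  have "mpc_run k alg (Suc 2) ?X = map_pmf (\<lambda>a. [state3 a, state2 a, state1 a, ?X]) ?p"
    unfolding mpc_run.simps(2) 2 bind_map_pmf by (simp only: round3 list.sel map_return_pmf map_pmf_def bind_return_pmf)
  then show ?thesis by (simp only: Suc_numeral semiring_norm)
qed

text \<open>Both sides are images of the same random assignment, which is coupled with
  itself.\<close>

lemma output_coupled:
  "rel_pmf (\<lambda>T M. stores k d V lab (hd T) M) (mpc_run k alg 3 (input_state n lab L))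
     (greedy_output k MM E)"
proof -
  have "stores k d V lab (state3 a) (result a)" for a
    unfolding stores_def
  proof (intro exI[of _ "\<lambda>j i. if i = 0 \<and> j = 0 then listing (result a) else []"] conjI allI impI)
    show "result a = (\<Union>j<k. \<Union>i<k. set (if i = 0 \<and> j = 0 then listing (result a) else []))"
      using k listing(2)[OF result_edges] by (auto split: if_splits)
  qed (auto simp: state3_def encode_def V edges_bits_def uniform_iff listing(2)[OF result_edges]
      result_edges[THEN subsetD])
  then show ?thesis
    unfolding run greedy_output_eq pmf.rel_map
    by (intro rel_pmf_reflI) (simp add: result_def part_def)
qed

text \<open>Here \<open>B\<close> counts edges. In the first round a machine receives its part and
  sends at most its input; in the second, machine 0 receives all the matchings together; the result
  of the third is contained in their union.\<close>

lemma within_space_run: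
  assumes X: "within_space k (B * block) (input_state n lab L)"
    and load: "\<And>i. i < k \<Longrightarrow> card (part a i) \<le> B"
    and total: "(\<Sum>i<k. card (MM i (part a i))) \<le> B"
  shows "within_space k (B * block) (state1 a)" "within_space k (B * block) (state2 a)"
    "within_space k (B * block) (state3 a)"
proof -
  have fin: "finite (MM i (part a i))" for i
    using MM_part_edges finite_edges by (rule finite_subset)
  have len1: "length (state1 a j i) = length (filter (\<lambda>e. a e = j) (L i)) * block" if "i < k" for i j
    using that L_edges[OF that] by (subst state1_def, simp, subst length_edges_bits) auto
  have "(\<Sum>j<k. length (state1 a i j)) = card (part a i) * block" for i
    by (simp add: len1 sum_distrib_right[symmetric] sum_length_filter_concat[OF L] part_def)
  moreover have "(\<Sum>j<k. length (state1 a j i)) \<le> B * block" if i: "i < k" for i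
  proof -
    have "(\<Sum>j<k. length (state1 a j i)) \<le> length (L i) * block"
      using i by (simp add: len1 sum_distrib_right[symmetric] sum_length_filter_eq_le)
    also have "\<dots> = (\<Sum>j<k. length (input_state n lab L i j))"
      using i L_edges[OF i] by (simp add: input_state_def length_edges_bits if_distrib cong: if_cong)
    also have "\<dots> \<le> B * block" using X i unfolding within_space_def by blast
    finally show ?thesis .
  qed
  ultimately show "within_space k (B * block) (state1 a)"
    using load by (simp add: within_space_def)
  have tot: "(\<Sum>i<k. card (MM i (part a i)) * block) \<le> B * block"
    using total by (simp add: sum_distrib_right[symmetric])
  have len2: "length (state2 a j i) = (if j = 0 then card (MM i (part a i)) * block else 0)"
    if "i < k" for i j
    using that MM_part_edges by (simp add: state2_def length_encode)
  have "(\<Sum>j<k. length (state2 a i j)) \<le> B * block" for i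
    using tot by (cases "i = 0") (simp_all add: len2)
  moreover have "(\<Sum>j<k. length (state2 a j i)) \<le> B * block" if i: "i < k" for i
  proof -
    have "(\<Sum>j<k. length (state2 a j i)) = card (MM i (part a i)) * block"
      using i k by (simp add: len2)
    also have "\<dots> \<le> (\<Sum>i<k. card (MM i (part a i)) * block)"
      using i by (intro member_le_sum) auto
    finally show ?thesis using tot by simp
  qed
  ultimately show "within_space k (B * block) (state2 a)" by (simp add: within_space_def)
  have "card (result a) \<le> card (\<Union>i<k. MM i (part a i))"
    using fin by (intro card_mono result_subset) auto
  also have "\<dots> \<le> (\<Sum>i<k. card (MM i (part a i)))" by (rule card_UN_le) simp
  finally have "card (result a) * block \<le> B * block" using total by simp
  then have "length (encode (result a)) \<le> B * block" by (simp add: length_encode result_edges)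
  then have "(\<Sum>j<k. length (state3 a i j)) \<le> B * block \<and> (\<Sum>j<k. length (state3 a j i)) \<le> B * block"
    for i using k by (cases "i = 0") (simp_all add: state3_def if_distrib[of length] cong: if_cong)
  then show "within_space k (B * block) (state3 a)" by (simp add: within_space_def)
qed

text \<open>The first bound, by disjointness of the parts, serves the case \<open>m \<le> n\<close>;
  the second one, by disjoint nonempty edges within \<open>n\<close> vertices, serves the case
  \<open>n < m\<close>.\<close>

lemma sum_card_MM_part_le:
  "(\<Sum>i<k. card (MM i (part a i))) \<le> card E" "(\<Sum>i<k. card (MM i (part a i))) \<le> k * n"
proof -
  have finE: "finite E" using E by (rule uniform_hypergraph_finite)
  have "(\<Sum>i<k. card (MM i (part a i))) \<le> (\<Sum>i<k. card (part a i))"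
    using finE MM_part(1) by (intro sum_mono card_mono) (auto simp: part_def)
  also have "\<dots> = card (\<Union>i<k. part a i)"
    using finE by (intro card_UN_disjoint[symmetric]) (auto simp: part_def)
  also have "\<dots> \<le> card E" using finE by (intro card_mono) (auto simp: part_def)
  finally show "(\<Sum>i<k. card (MM i (part a i))) \<le> card E" .
  have "card (MM i (part a i)) \<le> n" for i
  proof -
    have "e \<inter> V \<noteq> {}" if "e \<in> MM i (part a i)" for e
    proof -
      have "e \<subseteq> V" "card e = d" using that MM_part_edges[of i a] by (auto simp: edges_def)
      then show ?thesis using d by (auto simp: Int_absorb2)
    qed
    then show ?thesis
      using card_le_of_pairwise_disjnt_meets(2)[OF MM_part(2)] V by metis
  qed
  then show "(\<Sum>i<k. card (MM i (part a i))) \<le> k * n"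
    using sum_bounded_above[of "{..<k}" "\<lambda>i. card (MM i (part a i))" n] by simp
qed

end

section \<open>Load of the machines\<close>

text \<open>Markov's inequality for 2 to the power of the load, whose expectation is
  \<open>(1 + 1 / k) ^ card E\<close> by independence of the edges.\<close>

lemma prob_load_ge:
  assumes E: "finite E" and k: "i < k"
  shows "measure_pmf.prob (assignment k E) {a. t \<le> card {e\<in>E. a e = i}} \<le>
    exp (real (card E) / k) / 2 ^ t"
proof -
  let ?p = "assignment k E"
  have int: "integrable (measure_pmf ?p) (h :: _ \<Rightarrow> real)" for h
    using E k by (intro integrable_measure_pmf_finite) auto
  have pow: "(2::real) ^ card {e\<in>E. a e = i} = (\<Prod>e\<in>E. if a e = i then 2 else 1)" for a :: "_ \<Rightarrow> nat"
    using E by (simp add: prod.If_cases Int_def)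
  have U: "measure_pmf.expectation (pmf_of_set {..<k}) (\<lambda>v. if v = i then 2 else 1 :: real) = 1 + 1 / k"
  proof -
    have "(\<Sum>v<k. if v = i then 2 else 1 :: real) = (\<Sum>v<k. 1 + of_bool (v = i))"
      by (intro sum.cong) auto
    also have "\<dots> = k + 1" using k by (simp add: sum.distrib of_bool_def)
    finally show ?thesis using k by (simp add: integral_pmf_of_set lessThan_empty_iff field_simps)
  qed
  have "measure_pmf.expectation ?p (\<lambda>a. 2 ^ card {e\<in>E. a e = i}) = (1 + 1 / real k) ^ card E"
    unfolding pow assignment_def using k
    by (subst expectation_prod_Pi_pmf[OF E])
       (auto simp: U intro!: integrable_measure_pmf_finite)
  also have "\<dots> \<le> exp (1 / k) ^ card E"
    using exp_ge_add_one_self[of "1 / real k"] by (intro power_mono) auto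
  also have "\<dots> = exp (real (card E) / k)"
    by (simp add: exp_of_nat_mult[symmetric])
  finally have mgf: "measure_pmf.expectation ?p (\<lambda>a. 2 ^ card {e\<in>E. a e = i}) \<le> exp (real (card E) / k)" .
  have "{a. t \<le> card {e\<in>E. a e = i}} = {a. (2::real) ^ t \<le> 2 ^ card {e\<in>E. a e = i}}"
    by simp
  also have "measure_pmf.prob ?p \<dots> \<le> measure_pmf.expectation ?p (\<lambda>a. 2 ^ card {e\<in>E. a e = i}) / 2 ^ t"
    using integral_Markov_inequality_measure[of "measure_pmf ?p" "\<lambda>a. 2 ^ card {e\<in>E. a e = i}" "{}" "2 ^ t"] int
    by simp
  also have "\<dots> \<le> exp (real (card E) / k) / 2 ^ t"
    using mgf by (intro divide_right_mono) auto
  finally show ?thesis .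
qed

section \<open>Rounding of the square roots and the resulting load bounds\<close>

definition root_size :: "nat \<Rightarrow> nat \<Rightarrow> nat" where
  "root_size n m = nat \<lceil>sqrt (real n * real m)\<rceil>"

lemma root_size_bounds:
  "sqrt (real n * real m) \<le> root_size n m"
  "n > 0 \<Longrightarrow> m > 0 \<Longrightarrow> root_size n m \<le> 2 * sqrt (real n * real m)"
  "n \<le> m \<Longrightarrow> n \<le> root_size n m" "m \<le> n \<Longrightarrow> m \<le> root_size n m"
proof -
  have nn: "0 \<le> sqrt (real n * real m)" by simp
  show *: "sqrt (real n * real m) \<le> root_size n m"
    unfolding root_size_def by (rule real_nat_ceiling_ge)
  show "root_size n m \<le> 2 * sqrt (real n * real m)" if "n > 0" "m > 0"
  proof -
    have "n * m \<ge> 1" using that by simp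
    then have "1 \<le> sqrt (real n * real m)"
      by (metis of_nat_1 of_nat_le_iff of_nat_mult real_sqrt_ge_1_iff)
    moreover have "root_size n m < sqrt (real n * real m) + 1"
      unfolding root_size_def using nn by linarith
    ultimately show ?thesis by linarith
  qed
  have sq: "real x \<le> sqrt (real n * real m)" if "x * x \<le> n * m" for x
    using that by (intro real_le_rsqrt)
      (metis of_nat_le_iff of_nat_mult power2_eq_square)
  show "n \<le> root_size n m" if "n \<le> m" using sq[of n] * that by (simp add: mult_le_mono)
  show "m \<le> root_size n m" if "m \<le> n" using sq[of m] * that by (simp add: mult_le_mono)
qed

lemma num_machines_bounds:
  "num_machines n m > 0" "real (num_machines n m) \<le> 1 + sqrt (real m / real n)"
  "sqrt (real m / real n) \<le> num_machines n m"
proof -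
  have nn: "0 \<le> sqrt (real m / real n)" by simp
  show "num_machines n m > 0" by (simp add: num_machines_def)
  show "real (num_machines n m) \<le> 1 + sqrt (real m / real n)"
    unfolding num_machines_def using nn by linarith
  show "sqrt (real m / real n) \<le> num_machines n m"
    unfolding num_machines_def by linarith
qed

lemma sqrt_quotient_mult: "n > 0 \<Longrightarrow> sqrt (real m / real n) * real n = sqrt (real n * real m)"
proof -
  assume "n > 0"
  then have "sqrt (real m / real n) * sqrt (real n * real n) = sqrt (real n * real m)"
    unfolding real_sqrt_mult[symmetric] by (simp add: field_simps)
  then show ?thesis by simp
qed

lemma sqrt_quotient_le: "n > 0 \<Longrightarrow> sqrt (real m / real n) \<le> sqrt (real n * real m)"
proof -
  assume n: "n > 0"
  have "sqrt (real m / real n) * 1 \<le> sqrt (real m / real n) * real n"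
    using n by (intro mult_left_mono) auto
  then show ?thesis using sqrt_quotient_mult[OF n, of m] by simp
qed

text \<open>This limits what machine 0 receives in the second round: \<open>k\<close> matchings with
  at most \<open>n\<close> edges each.\<close>

lemma num_machines_mult_le:
  assumes "0 < n" "n \<le> m" shows "num_machines n m * n \<le> 2 * root_size n m"
proof -
  have "real (num_machines n m) * n \<le> (1 + sqrt (real m / real n)) * n"
    using num_machines_bounds(2) by (intro mult_right_mono) auto
  also have "\<dots> = n + sqrt (real n * real m)"
    using assms sqrt_quotient_mult[of n m] by (simp add: algebra_simps)
  also have "\<dots> \<le> real (root_size n m) + real (root_size n m)"
    using root_size_bounds(1)[of n m] root_size_bounds(3)[OF assms(2)] by (intro add_mono) auto
  finally have "real (num_machines n m * n) \<le> real (2 * root_size n m)" by simp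
  then show ?thesis by (simp only: of_nat_le_iff)
qed

text \<open>The expected load \<open>m / k\<close> is at most \<open>q = root_size n m\<close>, so
  one machine exceeds \<open>4 * q\<close> with probability at most
  \<open>(exp 1 / 16) ^ q \<le> (1 / 4) ^ q\<close>. The union bound over
  \<open>k \<le> 2 ^ q\<close> machines leaves \<open>(1 / 2) ^ q\<close>, and
  \<open>n \<le> q\<close>.\<close>

lemma prob_overload_le:
  assumes E: "finite E" "card E = m" and n: "0 < n" "n \<le> m" and k: "k = num_machines n m"
  shows "measure_pmf.prob (assignment k E) {a. \<exists>i<k. card {e\<in>E. a e = i} > 4 * root_size n m} \<le>
    (1 / 2) ^ n"
proof -
  let ?q = "root_size n m" and ?P = "measure_pmf.prob (assignment k E)"
  have k0: "k > 0" using k num_machines_bounds by simp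
  have kge: "sqrt (real m / real n) \<le> k" using k num_machines_bounds by simp
  have "real m = sqrt (real m / real n) * sqrt (real n * real m)"
    using n by (simp add: real_sqrt_mult[symmetric])
  also have "\<dots> \<le> k * sqrt (real n * real m)" using kge by (intro mult_right_mono) auto
  finally have "real m / k \<le> sqrt (real n * real m)" using k0 by (simp add: field_simps)
  also have "\<dots> \<le> ?q" by (rule root_size_bounds)
  finally have mk: "real m / k \<le> real ?q" .
  have one: "?P {a. 4 * ?q \<le> card {e\<in>E. a e = i}} \<le> (1 / 4) ^ ?q" if "i < k" for i
  proof -
    have "?P {a. 4 * ?q \<le> card {e\<in>E. a e = i}} \<le> exp (real m / k) / 2 ^ (4 * ?q)"
      using prob_load_ge[OF E(1) that, of "4 * ?q"] E by simp
    also have "\<dots> \<le> exp (real ?q) / 2 ^ (4 * ?q)" using mk by (intro divide_right_mono) auto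
    also have "\<dots> = (exp 1 / 16) ^ ?q"
      by (simp add: power_divide power_mult exp_of_nat_mult[symmetric])
    also have "\<dots> \<le> (1 / 4) ^ ?q" using exp_le by (intro power_mono) auto
    finally show ?thesis .
  qed
  have "real k \<le> 1 + real ?q"
    using num_machines_bounds(2)[of n m] sqrt_quotient_le[OF n(1), of m] root_size_bounds(1)[of n m]
    unfolding k by linarith
  also have "\<dots> \<le> 2 ^ ?q"
  proof -
    have "Suc ?q \<le> 2 ^ ?q" using less_exp[of ?q] by (rule Suc_leI)
    then have "real (Suc ?q) \<le> real (2 ^ ?q)" by (simp only: of_nat_le_iff)
    then show ?thesis by simp
  qed
  finally have k2: "real k \<le> 2 ^ ?q" .
  have "?P {a. \<exists>i<k. card {e\<in>E. a e = i} > 4 * ?q} \<le>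
      ?P (\<Union>i\<in>{..<k}. {a. 4 * ?q \<le> card {e\<in>E. a e = i}})"
    by (intro measure_pmf.finite_measure_mono) (auto intro: less_imp_le)
  also have "\<dots> \<le> (\<Sum>i<k. ?P {a. 4 * ?q \<le> card {e\<in>E. a e = i}})"
    by (intro measure_pmf.finite_measure_subadditive_finite) auto
  also have "\<dots> \<le> (\<Sum>i<k. (1 / 4) ^ ?q)" using one by (intro sum_mono) auto
  also have "\<dots> = real k * (1 / 4) ^ ?q" by simp
  also have "\<dots> \<le> 2 ^ ?q * (1 / 4) ^ ?q" using k2 by (intro mult_right_mono) auto
  also have "\<dots> = (1 / 2) ^ ?q" by (simp add: power_mult_distrib[symmetric])
  also have "\<dots> \<le> (1 / 2) ^ n" using root_size_bounds(3)[OF n(2)] by (intro power_decreasing) auto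
  finally show ?thesis .
qed

text \<open>Room for \<open>4 * root_size n m\<close> encoded edges; \<open>d\<close> is a constant,
  and the identifier width is logarithmic.\<close>

definition machine_space :: "nat \<Rightarrow> nat \<Rightarrow> nat \<Rightarrow> nat" where
  "machine_space d n m = 4 * root_size n m * (d * id_width n)"

lemma id_width_le: "real (id_width n) \<le> 2 * log 2 (real (n + m + 2))"
proof -
  have "0 \<le> log 2 (real n + 1)" by (subst zero_le_log_cancel_iff) auto
  then have "real (id_width n) \<le> log 2 (real n + 1) + 1"
    unfolding id_width_def by linarith
  also have "log 2 (real n + 1) \<le> log 2 (real (n + m + 2))"
    by (subst log_le_cancel_iff) auto
  also have "1 \<le> log 2 (real (n + m + 2))"
    by (subst one_le_log_cancel_iff) auto
  finally show ?thesis by simp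
qed

lemma machine_space_le:
  "real (machine_space d n m) \<le> 16 * real d * log 2 (real (n + m + 2)) * sqrt (real n * real m)"
proof (cases "n = 0 \<or> m = 0")
  case True
  then have "root_size n m = 0" by (auto simp: root_size_def)
  then show ?thesis using True by (auto simp: machine_space_def)
next
  case False
  have "real (machine_space d n m) = 4 * d * (real (id_width n) * real (root_size n m))"
    by (simp add: machine_space_def)
  also have "\<dots> \<le> 4 * d * ((2 * log 2 (real (n + m + 2))) * (2 * sqrt (real n * real m)))"
    using False by (intro mult_left_mono mult_mono id_width_le root_size_bounds(2)) auto
  also have "\<dots> = 16 * real d * log 2 (real (n + m + 2)) * sqrt (real n * real m)" by simp
  finally show ?thesis .
qed

lemma soft_O_machine_space:
  "soft_O (\<lambda>n m. real (machine_space d n m)) (\<lambda>n m. sqrt (real n * real m))"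
  unfolding soft_O_def
proof (rule exI[of _ "16 * real d"], rule exI[of _ 1], intro allI)
  fix n m :: nat
  show "\<bar>real (machine_space d n m)\<bar> \<le>
      16 * real d * log 2 (real (n + m + 2)) ^ 1 * sqrt (real n * real m)"
    unfolding power_one_right abs_of_nat by (rule machine_space_le)
qed

text \<open>The product of \<open>sqrt (m / n)\<close> and \<open>sqrt (n * m)\<close> is
  \<open>m\<close>; rounding up the number of machines costs one more \<open>sqrt (n * m)\<close>,
  which is at most \<open>n + m\<close>.\<close>

lemma soft_O_total_space:
  "soft_O (\<lambda>n m. real (num_machines n m) * real (machine_space d n m)) (\<lambda>n m. real (n + m))"
  unfolding soft_O_def
proof (rule exI[of _ "32 * real d"], rule exI[of _ 1], intro allI)
  fix n m :: nat
  let ?l = "log 2 (real (n + m + 2))" and ?s = "sqrt (real n * real m)"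
  have l: "0 \<le> ?l" by (subst zero_le_log_cancel_iff) auto
  have "real (num_machines n m) * ?s \<le> 2 * real (n + m)"
  proof (cases "n = 0")
    case False
    have "real (num_machines n m) * ?s \<le> (1 + sqrt (real m / real n)) * ?s"
      by (intro mult_right_mono num_machines_bounds) auto
    also have "\<dots> = ?s + m"
      using False by (simp add: algebra_simps real_sqrt_mult[symmetric])
    also have "?s \<le> real (n + m)"
      by (intro real_le_lsqrt) (auto simp: power2_eq_square algebra_simps)
    finally show ?thesis by simp
  qed simp
  then have "16 * real d * ?l * (real (num_machines n m) * ?s) \<le> 16 * real d * ?l * (2 * real (n + m))"
    using l by (intro mult_left_mono) auto
  moreover have "real (num_machines n m) * real (machine_space d n m) \<le>
      real (num_machines n m) * (16 * real d * ?l * ?s)"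
    by (intro mult_left_mono machine_space_le) auto
  ultimately show "\<bar>real (num_machines n m) * real (machine_space d n m)\<bar> \<le>
      32 * real d * ?l ^ 1 * real (n + m)"
    by (simp add: algebra_simps)
qed

context mpc_greedy_input begin

text \<open>If \<open>m \<le> n\<close>, then \<open>m \<le> root_size n m\<close> and all edges fit
  on one machine, so overload is impossible; otherwise \<open>prob_overload_le\<close>
  applies.\<close>

lemma prob_within_space_ge:
  assumes m: "card E = m" and k_eq: "k = num_machines n m"
    and X: "within_space k (machine_space d n m) (input_state n lab L)"
  shows "measure_pmf.prob (mpc_run k alg 3 (input_state n lab L))
    {T. \<forall>Y\<in>set T. within_space k (machine_space d n m) Y} \<ge> 1 - (1 / 2) ^ n"
proof -
  let ?B = "4 * root_size n m" and ?p = "assignment k E"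
  define good where "good = {a. \<forall>i<k. card {e\<in>E. a e = i} \<le> ?B}"
  have finE: "finite E" using E by (rule uniform_hypergraph_finite)
  have sp: "machine_space d n m = ?B * block" by (simp add: machine_space_def block_def)
  have total: "(\<Sum>i<k. card (MM i (part a i))) \<le> ?B" for a
  proof (cases "m \<le> n")
    case True
    then show ?thesis
      using sum_card_MM_part_le(1)[of a] root_size_bounds(4)[of m n] m by linarith
  next
    case False
    have "n > 0"
    proof (rule ccontr)
      assume "\<not> n > 0"
      then have "V = {}" using V by simp
      then have "e = {}" "card e = d" if "e \<in> E" for e
        using that E by (auto simp: uniform_hypergraph_def)
      then have "E = {}" using d by fastforce
      then show False using False m by simp
    qed
    then show ?thesis
      using sum_card_MM_part_le(2)[of a] num_machines_mult_le[of n m, folded k_eq] False by linarith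
  qed
  have sub: "\<forall>Y\<in>set [state3 a, state2 a, state1 a, input_state n lab L].
      within_space k (machine_space d n m) Y" if "a \<in> good" for a
  proof -
    have "card (part a i) \<le> ?B" if "i < k" for i
      using \<open>a \<in> good\<close> that by (simp add: good_def part_def)
    from within_space_run[OF X[unfolded sp] this total] show ?thesis
      using X by (simp add: sp)
  qed
  have "1 - (1 / 2) ^ n \<le> measure_pmf.prob ?p good"
  proof (cases "m \<le> n")
    case True
    have "card {e\<in>E. a e = i} \<le> ?B" for a :: "'a set \<Rightarrow> nat" and i
    proof -
      have "card {e\<in>E. a e = i} \<le> card E" using finE by (intro card_mono) auto
      then show ?thesis using root_size_bounds(4)[OF True] m by linarith
    qed
    then have "good = UNIV" by (auto simp: good_def)
    then show ?thesis by simp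
  next
    case False
    \<comment> \<open>For \<open>n = 0\<close> the claimed lower bound
      \<open>1 - (1 / 2) ^ n\<close> is 0.\<close>
    have "n > 0 \<or> n = 0" by auto
    moreover have ?thesis if "n > 0"
    proof -
      have "good = - {a. \<exists>i<k. card {e\<in>E. a e = i} > ?B}"
        by (auto simp: good_def not_less)
      then have "measure_pmf.prob ?p good = 1 - measure_pmf.prob ?p {a. \<exists>i<k. card {e\<in>E. a e = i} > ?B}"
        using measure_pmf.prob_compl[of "{a. \<exists>i<k. card {e\<in>E. a e = i} > ?B}" ?p]
        by (simp add: Compl_eq_Diff_UNIV)
      then show ?thesis using prob_overload_le[OF finE m that _ k_eq] False by simp
    qed
    ultimately show ?thesis by auto
  qed
  also have "\<dots> \<le> measure_pmf.prob (mpc_run k alg 3 (input_state n lab L))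
      {T. \<forall>Y\<in>set T. within_space k (machine_space d n m) Y}"
    unfolding run measure_map_pmf using sub
    by (intro measure_pmf.finite_measure_mono) auto
  finally show ?thesis .
qed

end

context mpc_greedy begin

text \<open>Probabilistic method: a random assignment overloads some machine with probability less
  than 1, so one without overload exists and serves as the initial distribution. The statement about
  runs is therefore not vacuous.\<close>

lemma distribution_exists:
  assumes E: "uniform_hypergraph d V E" and m: "card E = m" and k_eq: "k = num_machines n m"
  shows "\<exists>L. distributes k E L \<and> within_space k (machine_space d n m) (input_state n lab L)"
proof -
  let ?B = "4 * root_size n m" and ?p = "assignment k E"
  have finE: "finite E" using E by (rule uniform_hypergraph_finite)
  have EE: "E \<subseteq> edges" using E by (simp add: uniform_iff)
  have "\<exists>a\<in>set_pmf ?p. \<forall>i<k. card {e\<in>E. a e = i} \<le> ?B"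
  proof (cases "m \<le> n")
    case True
    have "card {e\<in>E. a e = i} \<le> ?B" for a :: "'a set \<Rightarrow> nat" and i
    proof -
      have "card {e\<in>E. a e = i} \<le> card E" using finE by (intro card_mono) auto
      then show ?thesis using root_size_bounds(4)[OF True] m by linarith
    qed
    moreover obtain a where "a \<in> set_pmf ?p" using set_pmf_not_empty[of ?p] by blast
    ultimately show ?thesis by blast
  next
    case False
    then have "E \<noteq> {}" using m by auto
    then obtain e where "e \<in> edges" using EE by auto
    then have n: "n > 0" using lab_image[of e] d by (cases n) auto
    show ?thesis
    proof (rule ccontr)
      assume "\<not> ?thesis"
      then have "set_pmf ?p \<subseteq> {a. \<exists>i<k. card {e\<in>E. a e = i} > ?B}"
        by (auto simp: not_le)
      then have "measure_pmf.prob ?p {a. \<exists>i<k. card {e\<in>E. a e = i} > ?B} = 1"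
        by (subst measure_pmf.prob_eq_1) (simp_all add: AE_measure_pmf_iff subset_iff)
      then have "(1 / 2 :: real) ^ n \<ge> 1"
        using prob_overload_le[OF finE m n _ k_eq] False by simp
      moreover have "(1 / 2 :: real) ^ n < 1" using power_strict_decreasing[OF n, of "1 / 2 :: real"] by simp
      ultimately show False by linarith
    qed
  qed
  then obtain a where a: "\<And>e. e \<in> E \<Longrightarrow> a e < k" "\<And>i. i < k \<Longrightarrow> card {e\<in>E. a e = i} \<le> ?B"
    using finE k by (auto simp: set_assignment PiE_dflt_def)
  define L where "L i = listing {e\<in>E. a e = i}" for i
  have L: "distinct (L i)" "set (L i) = {e\<in>E. a e = i}" for i
    using listing[of "{e\<in>E. a e = i}"] EE by (auto simp: L_def)
  have "distributes k E L"
    unfolding distributes_def distinct_concat_upt_iff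
    using L a(1) by (auto simp: atLeast0LessThan)
  moreover have "length (edges_bits n lab (L i)) \<le> machine_space d n m" if "i < k" for i
  proof -
    have "length (edges_bits n lab (L i)) = card {e\<in>E. a e = i} * block"
      using L[of i] EE distinct_card[OF L(1)[of i]] by (subst length_edges_bits) auto
    also have "\<dots> \<le> ?B * block" using a(2)[OF that] by simp
    finally show ?thesis by (simp add: machine_space_def block_def)
  qed
  then have "within_space k (machine_space d n m) (input_state n lab L)"
    by (simp add: within_space_def input_state_def if_distrib[of length] cong: if_cong)
  ultimately show ?thesis by blast
qed

end

lemma greedy_mpc_implementation:
  assumes "d \<ge> 1" "finite V" "card V = n" "k = num_machines n m" "maximum_matching_rule d V MM"
    and "bij_betw lab V {..<n}"
  shows "\<exists>A. \<forall>E. uniform_hypergraph d V E \<and> card E = m \<longrightarrow>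
    (\<exists>L. distributes k E L \<and> within_space k (machine_space d n m) (input_state n lab L)) \<and>
    (\<forall>L. distributes k E L \<and> within_space k (machine_space d n m) (input_state n lab L) \<longrightarrow>
       mpc_implements 3 k (machine_space d n m) ((1 / 2) ^ n) A (input_state n lab L)
         (stores k d V lab) (greedy_output k MM E))"
proof -
  interpret mpc_greedy d n k V lab MM
    using assms num_machines_bounds(1) by unfold_locales auto
  show ?thesis
  proof (intro exI[of _ alg] allI impI conjI)
    fix E assume 1: "uniform_hypergraph d V E \<and> card E = m"
    then show "\<exists>L. distributes k E L \<and> within_space k (machine_space d n m) (input_state n lab L)"
      using assms(4) by (intro distribution_exists) auto
    fix L assume 2: "distributes k E L \<and> within_space k (machine_space d n m) (input_state n lab L)"
    interpret mpc_greedy_input d n k V lab MM E L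
      using 1 2 by unfold_locales auto
    show "mpc_implements 3 k (machine_space d n m) ((1 / 2) ^ n) alg (input_state n lab L)
         (stores k d V lab) (greedy_output k MM E)"
      unfolding mpc_implements_def
      using 1 2 by (intro conjI output_coupled prob_within_space_ge assms(4)) auto
  qed
qed

lemma mpc_implements_mono:
  "mpc_implements R k s \<delta> A X out q \<Longrightarrow> \<delta> \<le> \<delta>' \<Longrightarrow> mpc_implements R k s \<delta>' A X out q"
  by (auto simp: mpc_implements_def)

text \<open>The Chebyshev error is of order
  \<open>1 / (\<epsilon>\<^sup>2 * matching_number E)\<close>, so it vanishes as the matching number
  grows; \<open>\<omega>\<close> is an arbitrarily slowly growing lower bound for that number. The
  error sequences depend on \<open>d\<close> and \<open>\<omega>\<close>, but not on the
  hypergraph.\<close>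

theorem theorem4p2:
  fixes d :: nat and \<omega> :: "nat \<Rightarrow> nat"
  assumes "d \<ge> 1"
    and "filterlim \<omega> at_top at_top"
  shows "\<exists>(\<epsilon> :: nat \<Rightarrow> real) (\<delta> :: nat \<Rightarrow> real) (s :: nat \<Rightarrow> nat \<Rightarrow> nat).
    \<epsilon> \<longlonglongrightarrow> 0 \<and> \<delta> \<longlonglongrightarrow> 0 \<and>
    soft_O (\<lambda>n m. real (s n m)) (\<lambda>n m. sqrt (real n * real m)) \<and>
    soft_O (\<lambda>n m. real (num_machines n m) * real (s n m)) (\<lambda>n m. real (n + m)) \<and>
    (\<forall>(V :: 'a set) n m k MM.
       finite V \<and> card V = n \<and> k = num_machines n m \<and> maximum_matching_rule d V MM \<longrightarrow>
       (\<forall>E. uniform_hypergraph d V E \<and> card E = m \<and> \<omega> n \<le> matching_number E \<longrightarrow>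
          measure_pmf.prob (greedy_output k MM E)
            {M. approximates (3 * real d * (real d - 1) + 3 + \<epsilon> n) E M} \<ge> 1 - \<delta> n) \<and>
       (\<forall>lab. bij_betw lab V {..<n} \<longrightarrow>
          (\<exists>A. \<forall>E. uniform_hypergraph d V E \<and> card E = m \<longrightarrow>
             (\<exists>L. distributes k E L \<and> within_space k (s n m) (input_state n lab L)) \<and>
             (\<forall>L. distributes k E L \<and> within_space k (s n m) (input_state n lab L) \<longrightarrow>
                mpc_implements 3 k (s n m) (\<delta> n) A (input_state n lab L)
                  (stores k d V lab) (greedy_output k MM E)))))"
proof -
  \<comment> \<open>This is twice the constant 153; the factor 2 pays for
    \<open>1 + \<omega> n \<le> 2 * matching_number E\<close>, valid for a positive matching
    number.\<close>
  define C where "C = 306 * (3 * real d * (real d - 1) + 4)\<^sup>2"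
  \<comment> \<open>The fourth root balances both demands: \<open>\<epsilon>\<close> tends to 0, and
    so does the failure bound of order \<open>1 / (\<epsilon>\<^sup>2 * (1 + \<omega> n)) = 1 / sqrt
    (1 + \<omega> n)\<close>. The added 1 ensures \<open>0 < \<epsilon> n \<le> 1\<close>.\<close>
  define \<epsilon> where "\<epsilon> n = 1 / sqrt (sqrt (1 + real (\<omega> n)))" for n
  \<comment> \<open>The first summand covers failure of the approximation, the second one overload
    of a machine.\<close>
  define \<delta> where "\<delta> n = C / sqrt (1 + real (\<omega> n)) + (1 / 2) ^ n" for n
  have \<omega>: "filterlim (\<lambda>n. sqrt (1 + real (\<omega> n))) at_top sequentially"
    by (intro filterlim_compose[OF sqrt_at_top] filterlim_tendsto_add_at_top[OF tendsto_const]
        filterlim_compose[OF filterlim_real_sequentially assms(2)])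
  have "\<epsilon> \<longlonglongrightarrow> 0"
    unfolding \<epsilon>_def
    by (rule tendsto_divide_0[OF tendsto_const])
       (rule filterlim_at_top_imp_at_infinity[OF filterlim_compose[OF sqrt_at_top \<omega>]])
  moreover have "\<delta> \<longlonglongrightarrow> 0"
  proof -
    have "(\<lambda>n. C / sqrt (1 + real (\<omega> n))) \<longlonglongrightarrow> 0"
      by (rule tendsto_divide_0[OF tendsto_const]) (rule filterlim_at_top_imp_at_infinity[OF \<omega>])
    moreover have "(\<lambda>n. (1 / 2 :: real) ^ n) \<longlonglongrightarrow> 0" by (rule LIMSEQ_power_zero) simp
    ultimately show ?thesis unfolding \<delta>_def by (auto intro: tendsto_eq_intros)
  qed
  moreover have C: "C \<ge> 0" by (simp add: C_def)
  have approx: "measure_pmf.prob (greedy_output k MM E)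
      {M. approximates (3 * real d * (real d - 1) + 3 + \<epsilon> n) E M} \<ge> 1 - \<delta> n"
    if "maximum_matching_rule d V MM" "uniform_hypergraph d V E" "\<omega> n \<le> matching_number E" "k > 0"
    for V :: "'a set" and n k MM E
  proof -
    let ?r = "sqrt (1 + real (\<omega> n))" and ?\<mu> = "real (matching_number E)"
    have r: "?r \<ge> 1" by simp
    have \<epsilon>: "0 < \<epsilon> n" "\<epsilon> n \<le> 1" "(\<epsilon> n)\<^sup>2 = 1 / ?r"
      by (simp_all add: \<epsilon>_def power_divide)
    have "1 - C / ?r \<le> 1 - 153 * (3 * real d * (real d - 1) + 4)\<^sup>2 / ((\<epsilon> n)\<^sup>2 * ?\<mu>)"
    proof (cases "matching_number E = 0")
      case True
      then show ?thesis using C by simp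
    next
      case False
      then have "?r * ?r \<le> 2 * ?\<mu>" using that(3) by simp
      then have "?r / ?\<mu> \<le> 2 / ?r" using False r by (simp add: field_simps)
      then have "C / 2 * (?r / ?\<mu>) \<le> C / 2 * (2 / ?r)" using C by (intro mult_left_mono) auto
      then show ?thesis by (simp add: C_def \<epsilon>(3))
    qed
    also have "\<dots> \<le> measure_pmf.prob (greedy_output k MM E)
        {M. approximates (3 * real d * (real d - 1) + 3 + \<epsilon> n) E M}"
      by (rule prob_greedy_approximates_ge[OF assms(1) that(4,2,1) \<epsilon>(1,2)])
    moreover have "(0::real) \<le> (1 / 2) ^ n" by simp
    ultimately show ?thesis unfolding \<delta>_def by linarith
  qed
  have \<delta>: "(1 / 2) ^ n \<le> \<delta> n" for n using C by (simp add: \<delta>_def)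
  show ?thesis
  proof (rule exI[of _ \<epsilon>], rule exI[of _ \<delta>], rule exI[of _ "machine_space d"], intro conjI allI impI)
    fix V :: "'a set" and n m k MM lab
    assume *: "finite V \<and> card V = n \<and> k = num_machines n m \<and> maximum_matching_rule d V MM"
      and lab: "bij_betw lab V {..<n}"
    then obtain A where A: "\<forall>E. uniform_hypergraph d V E \<and> card E = m \<longrightarrow>
      (\<exists>L. distributes k E L \<and> within_space k (machine_space d n m) (input_state n lab L)) \<and>
      (\<forall>L. distributes k E L \<and> within_space k (machine_space d n m) (input_state n lab L) \<longrightarrow>
         mpc_implements 3 k (machine_space d n m) ((1 / 2) ^ n) A (input_state n lab L)
           (stores k d V lab) (greedy_output k MM E))"
      using greedy_mpc_implementation[OF assms(1), of V n k m MM lab] by blast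
    then show "\<exists>A. \<forall>E. uniform_hypergraph d V E \<and> card E = m \<longrightarrow>
      (\<exists>L. distributes k E L \<and> within_space k (machine_space d n m) (input_state n lab L)) \<and>
      (\<forall>L. distributes k E L \<and> within_space k (machine_space d n m) (input_state n lab L) \<longrightarrow>
         mpc_implements 3 k (machine_space d n m) (\<delta> n) A (input_state n lab L)
           (stores k d V lab) (greedy_output k MM E))"
      using mpc_implements_mono[OF _ \<delta>] by blast
  next
    fix V :: "'a set" and n m k MM E
    assume "finite V \<and> card V = n \<and> k = num_machines n m \<and> maximum_matching_rule d V MM"
      and "uniform_hypergraph d V E \<and> card E = m \<and> \<omega> n \<le> matching_number E"
    then show "measure_pmf.prob (greedy_output k MM E)
        {M. approximates (3 * real d * (real d - 1) + 3 + \<epsilon> n) E M} \<ge> 1 - \<delta> n"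
      using approx num_machines_bounds(1) by blast
  qed (use calculation soft_O_machine_space soft_O_total_space in auto)
qed

end
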